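(* Let $n$ be a positive integer with $n\equiv 1\pmod 4$, let $a,b$ be indeterminates, and let $M=(n-1)/2$ or $M=n-1$. Then, modulo $[n](1-aq^n)(a-q^n)(1-bq^n)(b-q^n)$, \[ \sum_{k=0}^{M}[6k+1]\frac{(aq,q/a;q^2)_k(q^2,bq,q/b;q^4)_k}{(q^4,q^4/a,aq^4;q^4)_k(q^2/b,bq^2;q^2)_k}q^{2k} \equiv\frac{(1-aq^n)(a-q^n)(-1-b^2+bq^n)}{(b-a)(1-ba)}\frac{(q^5,aq^2,q^2/a;q^4)_{(n-1)/4}}{(q,q^4/a,aq^4;q^4)_{(n-1)/4}} +\frac{(1-bq^n)(b-q^n)(-1-a^2+aq^n)}{(a-b)(1-ab)}\frac{(q^5,bq^2,q^2/b;q^4)_{(n-1)/4}}{(q,q^4/b,bq^4;q^4)_{(n-1)/4}}. \]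
   Context: For $x$ and integer $n\ge 0$, $(x;q)_n=\prod_{j=0}^{n-1}(1-xq^j)$, and $(x_1,\dots,x_m;q)_n=(x_1;q)_n\cdots(x_m;q)_n$. $[r]=(1-q^r)/(1-q)$ is the $q$-integer. A congruence modulo a polynomial $P$ in $q,a,b$ between rational functions whose denominators are coprime to $P$ means that the difference is a rational function whose numerator is divisible by $P$ and whose denominator is coprime to $P$. *)

theory Defs
  imports "HOL-Computational_Algebra.Computational_Algebra"
begin

text \<open>
  Polynomials in three indeterminates $q$, $a$, $b$ over the rationals are represented as
  \<open>\<rat>[q][a][b]\<close>, i.e. $q$ is the innermost and $b$ the outermost indeterminate.
  Rational functions are elements of the fraction field.
\<close>

type_synonym poly_qab = "rat poly poly poly"
type_synonym ratfun_qab = "rat poly poly poly fract"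

definition indet_q :: ratfun_qab where
  "indet_q = to_fract [:[:[:0, 1:]:]:]"

definition indet_a :: ratfun_qab where
  "indet_a = to_fract [:[:0, 1:]:]"

definition indet_b :: ratfun_qab where
  "indet_b = to_fract [:0, 1:]"

definition qpoch :: "'a::comm_ring_1 \<Rightarrow> 'a \<Rightarrow> nat \<Rightarrow> 'a" where
  "qpoch x q n = (\<Prod>j<n. 1 - x * q ^ j)"

definition qpochs :: "'a::comm_ring_1 list \<Rightarrow> 'a \<Rightarrow> nat \<Rightarrow> 'a" where
  "qpochs xs q n = (\<Prod>x\<leftarrow>xs. qpoch x q n)"

definition qint :: "'a::field \<Rightarrow> nat \<Rightarrow> 'a" where
  "qint q r = (1 - q ^ r) / (1 - q)"

text \<open>
  The denominator of a rational function is understood after cancellation: some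
  representation as a fraction must have a denominator coprime to \<open>P\<close>.
\<close>

definition denom_coprime :: "'a::{idom, algebraic_semidom} \<Rightarrow> 'a fract \<Rightarrow> bool" where
  "denom_coprime P f \<longleftrightarrow> (\<exists>N D. D \<noteq> 0 \<and> coprime D P \<and> f = Fract N D)"

text \<open>
  The modulus \<open>m\<close> is written as an element of the fraction field (it contains a $q$-integer,
  which is a quotient), but is required to be a polynomial \<open>P\<close>.
\<close>

definition ratfun_cong :: "'a::{idom, algebraic_semidom} fract \<Rightarrow> 'a fract \<Rightarrow> 'a fract \<Rightarrow> bool" where
  "ratfun_cong m f g \<longleftrightarrow>
     (\<exists>P. m = to_fract P \<and> denom_coprime P f \<and> denom_coprime P g \<and>
        (\<exists>N D. D \<noteq> 0 \<and> coprime D P \<and> P dvd N \<and> f - g = Fract N D))"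

end

theory Submission
  imports Defs "HOL-Computational_Algebra.Field_as_Ring"
begin

text \<open>
  The modulus is a product of pairwise coprime factors, so it suffices to compare both sides at
  \<open>a = q\<^sup>\<plusminus>\<^sup>n\<close>, at \<open>b = q\<^sup>\<plusminus>\<^sup>n\<close>, and at every complex root of unity \<open>q = \<zeta> \<noteq> 1\<close> with
  \<open>\<zeta>\<^sup>n = 1\<close> (\<open>[n]\<close> is squarefree).

  For \<open>b = q\<^sup>\<plusminus>\<^sup>n\<close> and \<open>a = q\<^sup>\<plusminus>\<^sup>n\<close> the sum terminates naturally and is evaluated by two
  terminating forms of the quadratic summation of Gasper and Rahman, each proved with a
  Wilf-Zeilberger certificate; the right-hand side interpolates these two evaluations.

  At a root of unity of order \<open>d\<close> both sides vanish. The right-hand side contains the factor \<open>[n]\<close>.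
  On the left the summand with index \<open>l d + r\<close>, \<open>r < d\<close>, is a constant depending on \<open>l\<close> times the
  summand with index \<open>r\<close>, so the sum splits into multiples of its first block. That block is
  the specialisation of a Gasper-Rahman sum with \<open>q\<^sup>2\<close> replaced by \<open>q\<^sup>2\<^sup>-\<^sup>2\<^sup>d\<close>, whose closed form has a
  factor vanishing at the root of unity.
\<close>

subsection \<open>A terminating quadratic summation\<close>

text \<open>The obstacle at a root of unity of order \<open>d\<close> is that
  \<open>(q^4;q^4)_k\<close> vanishes as soon as \<open>k >= d\<close>, so that later summands are
  formally 0/0, while the summation formulas demand that \<open>q\<close> be no root of unity.
  Identities are therefore proved in the field of rational functions, where \<open>q\<close> is
  generic, and then carried over as values of rational functions, which exist whenever some
  representation has a nonvanishing denominator. The same notion serves both demands of the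
  congruence: if a value exists, the denominator in lowest terms lies outside the kernel of the
  substitution; if the value is 0, the numerator lies inside it. With \<open>n = 4 * m + 1\<close>,
  putting \<open>b = q^n\<close> cuts the sum at \<open>m\<close>, and \<open>a = q^n\<close> cuts
  it at \<open>2 * m = (n - 1) / 2\<close>, so both upper limits are long enough. Two different
  summation formulas are needed because \<open>a\<close> and \<open>b\<close> occur in different
  bases, although the right-hand side is symmetric in them.\<close>

lemma qpoch_0 [simp]: "qpoch x q 0 = 1"
  by (simp add: qpoch_def)

lemma qpoch_Suc [simp]: "qpoch x q (Suc k) = qpoch x q k * (1 - x * q ^ k)"
  by (simp add: qpoch_def)

lemma qpochs_Nil [simp]: "qpochs [] q n = 1"
  and qpochs_Cons [simp]: "qpochs (x # xs) q n = qpoch x q n * qpochs xs q n"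
  by (simp_all add: qpochs_def)

text \<open>Both sides are the factorial of length \<open>k + 1\<close>. Stated without division,
  the rule also covers parameters equal to 1.\<close>

lemma qpoch_shift: "(1 - x) * qpoch (x * q) q k = qpoch x q k * (1 - x * q ^ k)"
proof (induction k)
  case (Suc k)
  have "(1 - x) * qpoch (x * q) q (Suc k) = ((1 - x) * qpoch (x * q) q k) * (1 - x * q * q ^ k)"
    by (simp add: mult.assoc)
  also have "\<dots> = qpoch x q (Suc k) * (1 - x * q ^ Suc k)"
    unfolding Suc.IH by (simp add: mult_ac)
  finally show ?case .
qed simp

lemma qpoch_shift2:
  "(1 - x) * (1 - x * q) * qpoch (x * q ^ 2) q k = qpoch x q k * (1 - x * q ^ k) * (1 - x * q * q ^ k)"
proof -
  have "(1 - x) * (1 - x * q) * qpoch (x * q ^ 2) q k = (1 - x) * ((1 - x * q) * qpoch (x * q * q) q k)"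
    by (simp add: power2_eq_square mult_ac)
  also have "\<dots> = ((1 - x) * qpoch (x * q) q k) * (1 - x * q * q ^ k)"
    unfolding qpoch_shift[of "x * q"] by (simp add: mult_ac)
  also have "\<dots> = qpoch x q k * (1 - x * q ^ k) * (1 - x * q * q ^ k)"
    unfolding qpoch_shift by simp
  finally show ?thesis .
qed

lemma qpoch_nonzero:
  fixes x q :: "'a::idom"
  assumes "\<And>j. j < k \<Longrightarrow> x * q ^ j \<noteq> 1"
  shows "qpoch x q k \<noteq> 0"
  using assms by (auto simp: qpoch_def dest: sym)

lemma qpoch_eq_0:
  fixes x q :: "'a::idom"
  assumes "x * q ^ j = 1" "j < k"
  shows "qpoch x q k = 0"
  using assms by (auto simp: qpoch_def intro!: bexI[of _ j])

text \<open>The Wilf-Zeilberger equation of the first sum, divided by the common summand and cleared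
  of denominators, with \<open>x\<close> for \<open>q^k\<close>. Of \<open>b\<close> only
  \<open>s = b + q / b\<close> survives, since
  \<open>(1 - b * x) * (1 - q / b * x) = 1 - s * x + q * x^2\<close>; \<open>d\<close> and
  \<open>y\<close> enter only through \<open>z = a * q * y\<close> and
  \<open>u = z / d\<close>.\<close>

lemma gr_wz_identity:
  fixes a q s u z x :: "'a::idom"
  shows "(1-a*x^3)*x*((1-z*s+q*z^2)*(q*z-a)*(1-a*u*x^2)*(q*u-x)*(u-x)-(q*z-a*x^2)*(1-a*u)*(1-z*x)*(1-q*z*x)*(1-u*s+q*u^2))
   = (1-q*u*z)*(1-q*z*x)*(1-x^2)*(q-a*s*x^2+a^2*x^4)*(z-a*u*x)*(u-x)
     - (1-q*u*z)*(1-a*x)*(1-s*x+q*x^2)*(u-z*x^2)*(q*z-a*x^2)*(1-a*u*x^2)"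
  by algebra

text \<open>The counterpart for the second sum. Here \<open>e\<close> stands for
  \<open>d / a + a / d\<close>, which makes \<open>1 - t * e + t^2\<close> split as
  \<open>(1 - a * t / d) * (1 - d * t / a)\<close>.\<close>

lemma gr2_wz_identity:
  fixes a q e w x :: "'a::idom"
  shows "(1-a*x^3)*x*((1-q*w*e+q^2*w^2)*(1-a*w)*(1-x*w)*(1-q*x*w)*(w-a*x^2) - (1-w*e+w^2)*(q*w-a)*(q*w-x)*(w-x)*(1-a*q*w*x^2))
   = w*(1-q*w^2)*(1-a*q*w*x^2)*(1-x^2)*(1-x*e+x^2)*(q-a*x)*(w-a*x^2)
     - w*(1-q*w^2)*(q*w-x)*(1-a*e*x^2+a^2*x^4)*(1-q*x^2)*(1-a*x)*(1-x*w)"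
  by algebra

text \<open>
  The summand of Gasper and Rahman, Basic Hypergeometric Series, (3.8.12), without its factor
  \<open>1 - a q\<^sup>3\<^sup>k\<close>; the series terminates at \<open>m\<close> if \<open>y = q\<^sup>2\<^sup>m\<close>.
\<close>

definition gr_factor :: "'a::field \<Rightarrow> 'a \<Rightarrow> 'a \<Rightarrow> 'a \<Rightarrow> 'a \<Rightarrow> nat \<Rightarrow> 'a" where
  "gr_factor q a b d y k =
     qpoch a q k * qpoch b q k * qpoch (q / b) q k
       * (qpoch d (q ^ 2) k * qpoch (1 / y) (q ^ 2) k * qpoch (a ^ 2 * q * y / d) (q ^ 2) k)
     / (qpoch (q ^ 2) (q ^ 2) k * qpoch (a * q ^ 2 / b) (q ^ 2) k * qpoch (a * b * q) (q ^ 2) k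
       * (qpoch (a * q / d) q k * qpoch (d / (a * y)) q k * qpoch (a * q * y) q k)) * q ^ k"

lemma gr_factor_Suc:
  fixes q a b d y :: "'a::field"
  shows "gr_factor q a b d y (Suc k) = gr_factor q a b d y k *
     (q * (1 - a * q ^ k) * (1 - b * q ^ k) * (1 - q / b * q ^ k)
       * (1 - d * (q ^ k)^2) * (1 - 1 / y * (q ^ k)^2) * (1 - a ^ 2 * q * y / d * (q ^ k)^2)
      / ((1 - q ^ 2 * (q ^ k)^2) * (1 - a * q ^ 2 / b * (q ^ k)^2) * (1 - a * b * q * (q ^ k)^2)
       * (1 - a * q / d * q ^ k) * (1 - d / (a * y) * q ^ k) * (1 - a * q * y * q ^ k)))"
proof -
  have e: "(q ^ 2) ^ k = (q ^ k)^2"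
    by (metis mult.commute power_mult)
  show ?thesis
    unfolding gr_factor_def qpoch_Suc e power_Suc by (simp add: mult_ac)
qed

text \<open>For the certificate both summands must be multiples of a single one. Passing from
  \<open>y\<close> to \<open>q^2 * y\<close> moves the parameters in base \<open>q^2\<close> by one
  step of their base and those in base \<open>q\<close> by two, hence the single and the double
  shifts.\<close>

lemma gr_factor_shift:
  fixes q a b d y x u z w :: "'a::field" and k :: nat
  defines "x \<equiv> q ^ k" and "u \<equiv> a * q * y / d" and "z \<equiv> a * q * y" and "w \<equiv> q ^ 2 * y"
  assumes nz: "q \<noteq> 0" "a \<noteq> 0" "d \<noteq> 0" "y \<noteq> 0"
    and ne: "w \<noteq> 1" "a * u * x ^ 2 \<noteq> 1" "u \<noteq> x" "q * u \<noteq> x" "u \<noteq> 1" "q * u \<noteq> 1"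
    "z * x \<noteq> 1" "q * z * x \<noteq> 1" "z \<noteq> 1" "q * z \<noteq> 1"
  shows "gr_factor q a b d y k = gr_factor q a b d w k *
     ((w - x ^ 2) * (1 - a * u) * (1 - z * x) * (1 - q * z * x) * (u - 1) * (q * u - 1)
     / ((w - 1) * (1 - a * u * x ^ 2) * (u - x) * (q * u - x) * (1 - z) * (1 - q * z)))"
proof -
  have nz': "u \<noteq> 0" "w \<noteq> 0"
    using nz by (auto simp: u_def w_def)
  have e: "(q ^ 2) ^ k = x ^ 2"
    unfolding x_def by (metis mult.commute power_mult)
  have "(1 - 1 / w) * qpoch (1 / y) (q ^ 2) k = qpoch (1 / w) (q ^ 2) k * (1 - 1 / w * x ^ 2)"
    using qpoch_shift[of "1 / w" "q ^ 2" k] nz unfolding e w_def by simp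
  then have s1: "qpoch (1 / y) (q ^ 2) k = qpoch (1 / w) (q ^ 2) k * ((w - x ^ 2) / (w - 1))"
    using ne nz' by (simp add: field_simps)
  have "(1 - a * u) * qpoch (a ^ 2 * q * w / d) (q ^ 2) k
       = qpoch (a ^ 2 * q * y / d) (q ^ 2) k * (1 - a * u * x ^ 2)"
    using qpoch_shift[of "a * u" "q ^ 2" k] unfolding e u_def w_def
    by (simp add: power2_eq_square mult_ac)
  then have s2: "qpoch (a ^ 2 * q * y / d) (q ^ 2) k
      = qpoch (a ^ 2 * q * w / d) (q ^ 2) k * ((1 - a * u) / (1 - a * u * x ^ 2))"
    using ne by (simp add: nonzero_eq_divide_eq mult.commute)
  have "(1 - 1 / (q * u)) * (1 - 1 / u) * qpoch (d / (a * y)) q k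
       = qpoch (d / (a * w)) q k * ((1 - x / (q * u)) * (1 - x / u))"
    using qpoch_shift2[of "1 / (q * u)" q k] nz unfolding u_def w_def x_def
    by (simp add: power2_eq_square mult_ac)
  moreover have "(1 - 1 / (q * u)) * (1 - 1 / u) = (q * u - 1) * (u - 1) / (q * u * u)"
    "(1 - x / (q * u)) * (1 - x / u) = (q * u - x) * (u - x) / (q * u * u)"
    using nz nz' by (auto simp: field_simps)
  ultimately have "(q * u - 1) * (u - 1) / (q * u * u) * qpoch (d / (a * y)) q k
      = qpoch (d / (a * w)) q k * ((q * u - x) * (u - x) / (q * u * u))"
    by simp
  then have s3: "qpoch (d / (a * y)) q k
      = qpoch (d / (a * w)) q k * ((q * u - x) * (u - x) / ((q * u - 1) * (u - 1)))"
    using ne nz nz' by (simp add: nonzero_eq_divide_eq mult_ac)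
  have "(1 - z) * (1 - q * z) * qpoch (a * q * w) q k
       = qpoch (a * q * y) q k * ((1 - z * x) * (1 - q * z * x))"
    using qpoch_shift2[of z q k] nz unfolding z_def w_def x_def
    by (simp add: power2_eq_square mult_ac)
  then have s4: "qpoch (a * q * y) q k
      = qpoch (a * q * w) q k * ((1 - z) * (1 - q * z) / ((1 - z * x) * (1 - q * z * x)))"
    using ne by (simp add: nonzero_eq_divide_eq mult_ac)
  show ?thesis
    unfolding gr_factor_def s1 s2 s3 s4 by (simp add: mult_ac)
qed

text \<open>
  The function \<open>g\<close> is the Wilf-Zeilberger certificate for the recurrence from \<open>m\<close> to \<open>m + 1\<close>,
  where \<open>y = q\<^sup>2\<^sup>m\<close>. It is taken relative to the summand for \<open>m + 1\<close>, so that it has no pole in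
  the range of summation.
\<close>

lemma gr_wz:
  fixes q a b d y u z w :: "'a::field" and k :: nat and g :: "'a \<Rightarrow> 'a"
  defines "x \<equiv> q ^ k" and "u \<equiv> a * q * y / d" and "z \<equiv> a * q * y" and "w \<equiv> q ^ 2 * y" and "s \<equiv> b + q / b"
  defines "g \<equiv> \<lambda>x. - ((1 - q*u*z) * (1 - q*z*x) * (1 - x^2) * (q - a*s*x^2 + a^2*x^4) * (z - a*u*x))
     / ((1 - z*s + q*z^2) * (q*z - a) * (1 - a*u*x^2) * (q*u - x) * x)"
  assumes nz: "q \<noteq> 0" "a \<noteq> 0" "b \<noteq> 0" "d \<noteq> 0" "y \<noteq> 0"
    and ne: "w \<noteq> 1" "a * u * x ^ 2 \<noteq> 1" "a * u * (q * x) ^ 2 \<noteq> 1" "u \<noteq> x" "q * u \<noteq> x" "u \<noteq> 1" "q * u \<noteq> 1"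
    "z * x \<noteq> 1" "q * z * x \<noteq> 1" "q * z * (q * x) \<noteq> 1" "z \<noteq> 1" "q * z \<noteq> 1"
    "(q * x) ^ 2 \<noteq> 1" "a * (q * x) ^ 2 \<noteq> b" "a * b * q * x ^ 2 \<noteq> 1" "a * (q * x) \<noteq> d"
    "a * q ^ 2 * y \<noteq> b" "a * b * q * y \<noteq> 1"
  shows "(1 - a * x ^ 3) * gr_factor q a b d w k
      - (1 - z) * (1 - q * z) * (1 - u*s + q*u^2) / ((1 - u) * (1 - q * u) * (1 - z*s + q*z^2))
          * ((1 - a * x ^ 3) * gr_factor q a b d y k)
    = gr_factor q a b d w (Suc k) * g (q * x) - gr_factor q a b d w k * g x"
proof -
  have x: "x \<noteq> 0" and nz': "u \<noteq> 0" "w \<noteq> 0" "z \<noteq> 0"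
    using nz by (auto simp: u_def w_def x_def z_def)
  have sigma: "1 - z*s + q*z^2 = (1 - a * q ^ 2 * y / b) * (1 - a * b * q * y)"
    using nz by (simp add: z_def s_def field_simps power2_eq_square)
  have sigma0: "1 - z*s + q*z^2 \<noteq> 0"
    unfolding sigma using ne(17,18) nz by (simp add: divide_eq_1_iff)
  have qza: "a * w = q * z" "q * z - a \<noteq> 0"
    using ne(1) nz by (auto simp: w_def z_def power2_eq_square field_simps)
  \<comment> \<open>A common denominator of \<open>g x\<close>, of \<open>g (q * x)\<close> times
    the ratio of consecutive summands, and of the quotient of the two summands. The factor
    \<open>u - x\<close> is absent from \<open>g x\<close> itself.\<close>
  define D where "D = (1 - z*s + q*z^2) * (q*z - a) * (1 - a*u*x^2) * (q*u - x) * (u - x) * x"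
  have Dx: "D = x * ((1 - z*s + q*z^2) * (q*z - a) * (1 - a*u*x^2) * (q*u - x) * (u - x))"
    by (simp add: D_def mult_ac)
  have D: "D \<noteq> 0"
    unfolding D_def using sigma0 qza(2) ne x by auto
  have gx: "g x = - ((1-q*u*z)*(1-q*z*x)*(1-x^2)*(q-a*s*x^2+a^2*x^4)*(z-a*u*x)*(u-x)) / D"
    unfolding g_def D_def using ne by (simp add: mult_ac)
  have "(w - x ^ 2) / (w - 1) = (a * (w - x ^ 2)) / (a * (w - 1))"
    using nz by simp
  also have "\<dots> = (q*z - a*x^2) / (q*z - a)"
    by (simp add: right_diff_distrib qza)
  finally have wq: "(w - x ^ 2) / (w - 1) = (q*z - a*x^2) / (q*z - a)" .
  have r: "(1 - z) * (1 - q * z) * (1 - u*s + q*u^2) / ((1 - u) * (1 - q * u) * (1 - z*s + q*z^2))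
      * ((w - x ^ 2) * (1 - a * u) * (1 - z * x) * (1 - q * z * x) * (u - 1) * (q * u - 1)
     / ((w - 1) * (1 - a * u * x ^ 2) * (u - x) * (q * u - x) * (1 - z) * (1 - q * z)))
     = x * ((q*z-a*x^2)*(1-a*u)*(1-z*x)*(1-q*z*x)*(1-u*s+q*u^2)) / D" (is "?l = _")
  proof -
    have "?l = (1 - z) * (1 - q * z) * (1 - u*s + q*u^2) / ((u - 1) * (q * u - 1) * (1 - z*s + q*z^2))
      * ((w - x ^ 2) / (w - 1) * (1 - a * u) * (1 - z * x) * (1 - q * z * x) * (u - 1) * (q * u - 1)
     / ((1 - a * u * x ^ 2) * (u - x) * (q * u - x) * (1 - z) * (1 - q * z)))"
      using minus_mult_minus[of "1 - u" "1 - q * u"] by (simp add: mult_ac)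
    also have "\<dots> = x * ((q*z-a*x^2)*(1-a*u)*(1-z*x)*(1-q*z*x)*(1-u*s+q*u^2)) / D"
      unfolding wq D_def using ne x by (simp add: mult_ac)
    finally show ?thesis .
  qed
  define \<beta> where "\<beta> = q * (1 - a * x) * (1 - b * x) * (1 - q / b * x)
       * (1 - d * x^2) * (1 - 1 / w * x^2) * (1 - a ^ 2 * q * w / d * x^2)
      / ((1 - q ^ 2 * x^2) * (1 - a * q ^ 2 / b * x^2) * (1 - a * b * q * x^2)
       * (1 - a * q / d * x) * (1 - d / (a * w) * x) * (1 - a * q * w * x))"
  have beta: "gr_factor q a b d w (Suc k) = gr_factor q a b d w k * \<beta>"
    unfolding gr_factor_Suc \<beta>_def x_def ..
  have "\<beta> * g (q * x) = - ((1-q*u*z)*(1-a*x)*(1-s*x+q*x^2)*(u-z*x^2)*(q*z-a*x^2)*(1-a*u*x^2)) / D"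
  proof -
    have e1: "(1 - b * x) * (1 - q / b * x) = 1 - s * x + q * x ^ 2"
      using nz by (simp add: s_def field_simps power2_eq_square)
    have e2: "1 - a ^ 2 * q * w / d * x^2 = 1 - a * u * (q * x) ^ 2"
      by (simp add: u_def w_def power2_eq_square mult_ac)
    have e3: "q - a * s * (q * x) ^ 2 + a^2 * (q * x)^4 = q * ((1 - a * q ^ 2 / b * x^2) * (1 - a * b * q * x^2))"
      using nz by (simp add: s_def field_simps power2_eq_square power4_eq_xxxx)
    have e4: "z - a * u * (q * x) = z * (1 - a * q / d * x)"
      using nz by (simp add: u_def z_def field_simps)
    have e5: "1 - a * q * w * x = 1 - q * z * (q * x)"
      by (simp add: w_def z_def power2_eq_square mult_ac)
    have e6: "1 - d / (a * w) * x = (q * u - x) / (q * u)"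
      using nz by (simp add: u_def w_def field_simps power2_eq_square)
    have e7: "1 - 1 / w * x ^ 2 = (q * z - a * x ^ 2) / (q * z)"
      using nz nz' unfolding qza(1)[symmetric] by (simp add: field_simps)
    have e8: "u * (1 - d * x ^ 2) = u - z * x ^ 2"
      using nz by (simp add: u_def z_def field_simps)
    have e9: "q * u - q * x = q * (u - x)" "q ^ 2 * x ^ 2 = (q * x) ^ 2"
      by (simp_all add: algebra_simps power_mult_distrib)
    have n3: "1 - a * q ^ 2 / b * x^2 \<noteq> 0" "1 - a * b * q * x^2 \<noteq> 0" "1 - a * q / d * x \<noteq> 0"
      "1 - (q * x) ^ 2 \<noteq> 0" "1 - a * u * (q * x) ^ 2 \<noteq> 0" "1 - q * z * (q * x) \<noteq> 0"
      using ne nz by (auto simp: field_simps power2_eq_square)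
    have cancel: "q*a1*c1*d1*(c2/(q*z))*p1/(p2*p3*p4*p5*(c3/(q*u))*p6) * (-(c*p6*p2*(q*(p3*p4))*(z*p5))/(c4*c5*p1*(q*c6)*(q*x)))
        = -(c*a1*c1*(u*d1)*c2)/(c4*c5*c3*c6*x)"
      if "p1 \<noteq> 0" "p2 \<noteq> 0" "p3 \<noteq> 0" "p4 \<noteq> 0" "p5 \<noteq> 0" "p6 \<noteq> 0"
      for a1 c1 d1 c2 p1 p2 p3 p4 p5 c3 p6 c c4 c5 c6
      using that nz nz' x by (simp add: mult_ac)
    have "\<beta> = q * (1 - a * x) * ((1 - b * x) * (1 - q / b * x)) * (1 - d * x^2) * (1 - 1 / w * x^2) * (1 - a ^ 2 * q * w / d * x^2)
      / ((1 - q ^ 2 * x^2) * (1 - a * q ^ 2 / b * x^2) * (1 - a * b * q * x^2)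
       * (1 - a * q / d * x) * (1 - d / (a * w) * x) * (1 - a * q * w * x))"
      unfolding \<beta>_def by (simp add: mult_ac)
    then have "\<beta> * g (q * x) = -((1-q*u*z)*(1-a*x)*(1-s*x+q*x^2)*(u*(1-d*x^2))*(q*z-a*x^2))
        / ((1 - z*s + q*z^2) * (q*z - a) * (q*u - x) * (u - x) * x)"
      unfolding g_def e1 e2 e3 e4 e5 e6 e7 e9 by (simp only: cancel[OF n3(5,4,1,2,3,6)])
    then show ?thesis
      unfolding D_def e8 using ne(2) by (simp add: mult_ac)
  qed
  then have "gr_factor q a b d w (Suc k) * g (q * x) - gr_factor q a b d w k * g x
     = gr_factor q a b d w k * (((1-q*u*z)*(1-q*z*x)*(1-x^2)*(q-a*s*x^2+a^2*x^4)*(z-a*u*x)*(u-x)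
     - (1-q*u*z)*(1-a*x)*(1-s*x+q*x^2)*(u-z*x^2)*(q*z-a*x^2)*(1-a*u*x^2)) / D)"
    unfolding beta gx by (simp add: diff_divide_distrib right_diff_distrib mult.assoc)
  also have "\<dots> = gr_factor q a b d w k * ((1-a*x^3) * (D - x * ((q*z-a*x^2)*(1-a*u)*(1-z*x)*(1-q*z*x)*(1-u*s+q*u^2))) / D)"
    unfolding gr_wz_identity[symmetric] by (simp only: Dx right_diff_distrib[symmetric] mult.assoc)
  also have "\<dots> = gr_factor q a b d w k * ((1-a*x^3) * (1 - x * ((q*z-a*x^2)*(1-a*u)*(1-z*x)*(1-q*z*x)*(1-u*s+q*u^2)) / D))"
    using D by (simp add: diff_divide_distrib right_diff_distrib)
  finally have eq: "gr_factor q a b d w (Suc k) * g (q * x) - gr_factor q a b d w k * g x = \<dots>" .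
  have alg: "f * (c * (1 - p * r)) = c * f - p * (c * (f * r))" for c f p r :: 'a
    by (simp add: algebra_simps)
  show ?thesis
    using eq
    unfolding gr_factor_shift[OF nz(1,2,4,5) ne(1,2,4,5,6,7,8,9,11,12)[unfolded x_def u_def z_def w_def], folded x_def u_def z_def w_def] r[symmetric] alg
    by (rule sym)
qed

lemma sum_telescope_Suc:
  fixes f :: "nat \<Rightarrow> 'a::ab_group_add"
  shows "(\<Sum>k\<le>n. f (Suc k) - f k) = f (Suc n) - f 0"
  by (induction n) simp_all

lemma gr_step:
  fixes q a b d :: "'a::field" and m :: nat
  assumes nz: "q \<noteq> 0" "a \<noteq> 0" "b \<noteq> 0" "d \<noteq> 0"
    and q: "\<And>j. j > 0 \<Longrightarrow> q ^ j \<noteq> 1" and a: "\<And>j. j > 0 \<Longrightarrow> a * q ^ j \<noteq> 1"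
    and d: "\<And>j. a * q ^ j \<noteq> d" and ad: "\<And>j. j > 0 \<Longrightarrow> a ^ 2 * q ^ j \<noteq> d"
    and b: "\<And>j. j > 0 \<Longrightarrow> a * q ^ j \<noteq> b" and ab: "\<And>j. j > 0 \<Longrightarrow> a * b * q ^ j \<noteq> 1"
  shows "(\<Sum>k\<le>Suc m. (1 - a * q ^ (3 * k)) * gr_factor q a b d (q ^ (2 * Suc m)) k)
    = (1 - a * q * q ^ (2 * m)) * (1 - a * q * q ^ (2 * m + 1))
        * ((1 - a * q ^ 2 / (b * d) * q ^ (2 * m)) * (1 - a * b * q / d * q ^ (2 * m)))
      / ((1 - a * q / d * q ^ (2 * m)) * (1 - a * q / d * q ^ (2 * m + 1))
        * ((1 - a * q ^ 2 / b * q ^ (2 * m)) * (1 - a * b * q * q ^ (2 * m))))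
      * (\<Sum>k\<le>m. (1 - a * q ^ (3 * k)) * gr_factor q a b d (q ^ (2 * m)) k)"
proof -
  define y where "y = q ^ (2 * m)"
  define u where "u = a * q * y / d"
  define z where "z = a * q * y"
  define w where "w = q ^ 2 * y"
  define s where "s = b + q / b"
  define g where "g = (\<lambda>x. - ((1 - q*u*z) * (1 - q*z*x) * (1 - x^2) * (q - a*s*x^2 + a^2*x^4) * (z - a*u*x))
     / ((1 - z*s + q*z^2) * (q*z - a) * (1 - a*u*x^2) * (q*u - x) * x))"
  define \<rho> where "\<rho> = (1 - z) * (1 - q * z) * (1 - u*s + q*u^2) / ((1 - u) * (1 - q * u) * (1 - z*s + q*z^2))"
  have y: "y \<noteq> 0" using nz by (simp add: y_def)
  have wy: "w = q ^ (2 * Suc m)"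
    by (simp add: w_def y_def power2_eq_square mult.assoc)
  have step: "(1 - a * (q ^ k) ^ 3) * gr_factor q a b d w k - \<rho> * ((1 - a * (q ^ k) ^ 3) * gr_factor q a b d y k)
      = gr_factor q a b d w (Suc k) * g (q ^ Suc k) - gr_factor q a b d w k * g (q ^ k)" if "k \<le> Suc m" for k
  proof -
    have pe: "q ^ (2 * j) = q ^ j * q ^ j" "q ^ (j * 2) = q ^ j * q ^ j" for j
      by (metis mult_2 power_add, metis mult_2_right power_add)
    note ps = pe power_add power2_eq_square power3_eq_cube mult_ac
    \<comment> \<open>This is where the range of \<open>k\<close> matters: since
      \<open>k <= m + 1 <= 2 * m + 1\<close>, the quotient of \<open>u\<close> by \<open>q^k\<close>
      is \<open>a * q^i / d\<close> with a natural exponent, so \<open>u \<noteq> q^k\<close>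
      follows from the hypothesis on \<open>d\<close>.\<close>
    obtain i where i: "2 * m + 1 = k + i"
      using \<open>k \<le> Suc m\<close> le_Suc_ex[of k "2 * m + 1"] by auto
    have "q * y = q ^ (2 * m + 1)"
      by (simp add: y_def)
    then have qy: "q * y = q ^ k * q ^ i"
      unfolding i power_add .
    have "w \<noteq> 1" using q[of "2 * Suc m"] by (simp only: wy) simp
    moreover have "a * u * (q ^ k) ^ 2 = a ^ 2 * q ^ (2 * m + 1 + 2 * k) / d"
      "a * u * (q * q ^ k) ^ 2 = a ^ 2 * q ^ (2 * m + 3 + 2 * k) / d"
      by (simp_all add: u_def y_def ps)
    then have "a * u * (q ^ k) ^ 2 \<noteq> 1" "a * u * (q * q ^ k) ^ 2 \<noteq> 1"
      using ad[of "2 * m + 1 + 2 * k"] ad[of "2 * m + 3 + 2 * k"] nz by (simp_all only: divide_eq_1_iff) simp_all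
    moreover have "u \<noteq> q ^ k"
      using d[of i] nz by (simp add: u_def qy mult.assoc divide_eq_eq)
    moreover have "q * u \<noteq> q ^ k"
      using d[of "Suc i"] nz by (simp add: u_def qy mult.assoc divide_eq_eq) (simp add: mult_ac)
    moreover have "u = a * q ^ (2 * m + 1) / d" "q * u = a * q ^ (2 * m + 2) / d"
      by (simp_all add: u_def y_def ps)
    then have "u \<noteq> 1" "q * u \<noteq> 1"
      using d[of "2 * m + 1"] d[of "2 * m + 2"] nz by (simp_all only: divide_eq_1_iff) simp_all
    moreover have "z * q ^ k = a * q ^ (2 * m + 1 + k)" "q * z * q ^ k = a * q ^ (2 * m + 2 + k)"
      "q * z * (q * q ^ k) = a * q ^ (2 * m + 3 + k)"
      by (simp_all add: z_def y_def ps)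
    then have "z * q ^ k \<noteq> 1" "q * z * q ^ k \<noteq> 1" "q * z * (q * q ^ k) \<noteq> 1"
      using a[of "2 * m + 1 + k"] a[of "2 * m + 2 + k"] a[of "2 * m + 3 + k"]
      by (simp_all only: add_gr_0 zero_less_numeral zero_less_one simp_thms)
    moreover have "z = a * q ^ (2 * m + 1)"
      by (simp add: z_def y_def ps)
    then have "z \<noteq> 1"
      using a[of "2 * m + 1"] by (simp only: add_gr_0 zero_less_numeral zero_less_one simp_thms)
    moreover have "q * z = a * q ^ (2 * m + 2)"
      by (simp add: z_def y_def ps)
    then have "q * z \<noteq> 1"
      using a[of "2 * m + 2"] by (simp only: add_gr_0 zero_less_numeral zero_less_one simp_thms)
    moreover have "(q * q ^ k) ^ 2 = q ^ (2 * k + 2)" "a * b * q * (q ^ k) ^ 2 = a * b * q ^ (2 * k + 1)"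
      "a * q ^ 2 * y = a * q ^ (2 * m + 2)" "a * b * q * y = a * b * q ^ (2 * m + 1)"
      by (simp_all add: y_def ps)
    then have "(q * q ^ k) ^ 2 \<noteq> 1" "a * (q * q ^ k) ^ 2 \<noteq> b" "a * b * q * (q ^ k) ^ 2 \<noteq> 1"
      "a * q ^ 2 * y \<noteq> b" "a * b * q * y \<noteq> 1"
      using q[of "2 * k + 2"] b[of "2 * k + 2"] ab[of "2 * k + 1"] b[of "2 * m + 2"] ab[of "2 * m + 1"]
      by (simp_all only: add_gr_0 zero_less_numeral zero_less_one simp_thms)
    moreover have "a * (q * q ^ k) \<noteq> d"
      using d[of "Suc k"] by simp
    ultimately show ?thesis
      unfolding \<rho>_def g_def u_def z_def w_def s_def power_Suc by (intro gr_wz nz y)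
  qed
  have "(\<Sum>k\<le>Suc m. (1 - a * q ^ (3 * k)) * gr_factor q a b d w k) - \<rho> * (\<Sum>k\<le>Suc m. (1 - a * q ^ (3 * k)) * gr_factor q a b d y k)
     = (\<Sum>k\<le>Suc m. gr_factor q a b d w (Suc k) * g (q ^ Suc k) - gr_factor q a b d w k * g (q ^ k))"
    unfolding sum_distrib_left sum_subtractf[symmetric]
    by (rule sum.cong) (simp_all only: step[symmetric] mult.commute[of 3] power_mult atMost_iff)
  also have "\<dots> = gr_factor q a b d w (Suc (Suc m)) * g (q ^ Suc (Suc m)) - gr_factor q a b d w 0 * g (q ^ 0)"
    by (rule sum_telescope_Suc)
  \<comment> \<open>Upper boundary term: the summand for \<open>m + 1\<close> vanishes from index
    \<open>m + 2\<close> on. The lower boundary term vanishes through the factor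
    \<open>1 - x^2\<close> of \<open>g\<close> at \<open>x = 1\<close>.\<close>
  also have "1 / w * (q ^ 2) ^ Suc m = 1"
    using nz by (simp only: wy power_mult) simp
  then have "gr_factor q a b d w (Suc (Suc m)) = 0"
    unfolding gr_factor_def by (subst qpoch_eq_0[of "1 / w" _ "Suc m"]) simp_all
  also have "g (q ^ 0) = 0" by (simp add: g_def)
  finally have "(\<Sum>k\<le>Suc m. (1 - a * q ^ (3 * k)) * gr_factor q a b d w k)
      = \<rho> * (\<Sum>k\<le>Suc m. (1 - a * q ^ (3 * k)) * gr_factor q a b d y k)"
    by simp
  \<comment> \<open>The summand for \<open>m\<close> already vanishes at index \<open>m + 1\<close>,
    so both sums could be taken up to \<open>m + 1\<close>.\<close>
  also have "1 / y * (q ^ 2) ^ m = 1"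
    using nz by (simp only: y_def power_mult) simp
  then have "gr_factor q a b d y (Suc m) = 0"
    unfolding gr_factor_def by (subst qpoch_eq_0[of "1 / y" _ m]) simp_all
  then have "(\<Sum>k\<le>Suc m. (1 - a * q ^ (3 * k)) * gr_factor q a b d y k) = (\<Sum>k\<le>m. (1 - a * q ^ (3 * k)) * gr_factor q a b d y k)"
    by simp
  also have "\<rho> = (1 - a * q * y) * (1 - a * q * (y * q))
        * ((1 - a * q ^ 2 / (b * d) * y) * (1 - a * b * q / d * y))
      / ((1 - a * q / d * y) * (1 - a * q / d * (y * q))
        * ((1 - a * q ^ 2 / b * y) * (1 - a * b * q * y)))"
  proof -
    have "1 - z*s + q*z^2 = (1 - a * q ^ 2 / b * y) * (1 - a * b * q * y)"
      "1 - u*s + q*u^2 = (1 - a * q ^ 2 / (b * d) * y) * (1 - a * b * q / d * y)"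
      using nz by (simp_all add: u_def z_def s_def field_simps power2_eq_square)
    then show ?thesis
      by (simp add: \<rho>_def u_def z_def mult_ac)
  qed
  finally show ?thesis
    unfolding wy unfolding y_def by (simp add: mult_ac)
qed

text \<open>Induction on \<open>m\<close>: the factor from \<open>gr_step\<close> supplies two new
  factors to each factorial in base \<open>q\<close> and one to each in base \<open>q^2\<close>. The
  hypotheses keep the denominators nonzero for all \<open>m\<close> at once and thereby exclude
  roots of unity.\<close>

lemma gasper_rahman_quadratic_sum:
  fixes q a b d :: "'a::field" and m :: nat
  assumes nz: "q \<noteq> 0" "a \<noteq> 0" "b \<noteq> 0" "d \<noteq> 0"
    and q: "\<And>j. j > 0 \<Longrightarrow> q ^ j \<noteq> 1" and a: "\<And>j. j > 0 \<Longrightarrow> a * q ^ j \<noteq> 1"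
    and d: "\<And>j. a * q ^ j \<noteq> d" and ad: "\<And>j. j > 0 \<Longrightarrow> a ^ 2 * q ^ j \<noteq> d"
    and b: "\<And>j. j > 0 \<Longrightarrow> a * q ^ j \<noteq> b" and ab: "\<And>j. j > 0 \<Longrightarrow> a * b * q ^ j \<noteq> 1"
  shows "(\<Sum>k\<le>m. (1 - a * q ^ (3 * k)) * gr_factor q a b d (q ^ (2 * m)) k)
    = (1 - a) * (qpoch (a * q) q (2 * m) * (qpoch (a * q ^ 2 / (b * d)) (q ^ 2) m * qpoch (a * b * q / d) (q ^ 2) m)
      / (qpoch (a * q / d) q (2 * m) * (qpoch (a * q ^ 2 / b) (q ^ 2) m * qpoch (a * b * q) (q ^ 2) m)))"
proof (induction m)
  case 0
  show ?case by (simp add: gr_factor_def)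
next
  case (Suc m)
  have e: "2 * Suc m = Suc (Suc (2 * m))" "(q ^ 2) ^ m = q ^ (2 * m)"
    by (simp_all add: power_mult)
  show ?case
    apply (subst gr_step[OF assms], assumption+)
    unfolding Suc.IH unfolding e qpoch_Suc power_Suc by (simp add: mult_ac)
qed

subsection \<open>A second terminating quadratic summation\<close>

text \<open>
  The same series with base-\<open>q\<^sup>2\<close> parameters \<open>d\<close>, \<open>a\<^sup>2 / d\<close>, \<open>q\<close>, terminated at \<open>2 m\<close> by
  \<open>b = q / w\<close> with \<open>w = q\<^sup>2\<^sup>m\<^sup>+\<^sup>1\<close>.
\<close>

definition gr2_factor :: "'a::field \<Rightarrow> 'a \<Rightarrow> 'a \<Rightarrow> 'a \<Rightarrow> nat \<Rightarrow> 'a" where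
  "gr2_factor q a d w k =
     qpoch (q / w) q k * qpoch w q k * (qpoch d (q ^ 2) k * qpoch (a ^ 2 / d) (q ^ 2) k * qpoch q (q ^ 2) k)
     / (qpoch (q ^ 2) (q ^ 2) k * qpoch (a * q * w) (q ^ 2) k * qpoch (a * q ^ 2 / w) (q ^ 2) k
       * (qpoch (a * q / d) q k * qpoch (d * q / a) q k)) * q ^ k"

lemma gr2_factor_Suc:
  fixes q a d w :: "'a::field"
  shows "gr2_factor q a d w (Suc k) = gr2_factor q a d w k *
     (q * (1 - q / w * q ^ k) * (1 - w * q ^ k) * ((1 - d * (q ^ k)^2) * (1 - a ^ 2 / d * (q ^ k)^2)) * (1 - q * (q ^ k)^2)
      / ((1 - q ^ 2 * (q ^ k)^2) * (1 - a * q * w * (q ^ k)^2) * (1 - a * q ^ 2 / w * (q ^ k)^2)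
       * ((1 - a * q / d * q ^ k) * (1 - d * q / a * q ^ k))))"
proof -
  have e: "(q ^ 2) ^ k = (q ^ k)^2"
    by (metis mult.commute power_mult)
  show ?thesis
    unfolding gr2_factor_def qpoch_Suc e power_Suc by (simp add: mult_ac)
qed

text \<open>The parameters \<open>q / w\<close> and \<open>w\<close> move by two steps of base
  \<open>q\<close>, and \<open>a * q * w\<close> and \<open>a * q^2 / w\<close> by one step of base
  \<open>q^2\<close>. The factorial of \<open>a\<close> in the first series does not appear here:
  for \<open>y = 1 / q\<close> it cancels against that of \<open>a * q * y\<close>.\<close>

lemma gr2_factor_shift:
  fixes q a d w x :: "'a::field" and k :: nat
  defines "x \<equiv> q ^ k"
  assumes nz: "q \<noteq> 0" "a \<noteq> 0" "d \<noteq> 0" "w \<noteq> 0"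
    and ne: "w \<noteq> 1" "q * w \<noteq> 1" "x * w \<noteq> 1" "q * x * w \<noteq> 1" "w \<noteq> a * x ^ 2" "w \<noteq> a"
       "a * q * w \<noteq> 1" "a * q * w * x ^ 2 \<noteq> 1"
  shows "gr2_factor q a d w k = gr2_factor q a d (q ^ 2 * w) k *
     ((q * w - x) * (w - x) * (1 - a * q * w * x ^ 2) * (w - a)
     / ((1 - x * w) * (1 - q * x * w) * (1 - a * q * w) * (w - a * x ^ 2)))"
proof -
  have e: "(q ^ 2) ^ k = x ^ 2"
    unfolding x_def by (metis mult.commute power_mult)
  have "(1 - 1 / (q * w)) * (1 - 1 / w) * qpoch (q / w) q k
       = qpoch (q / (q ^ 2 * w)) q k * ((1 - x / (q * w)) * (1 - x / w))"
    using qpoch_shift2[of "1 / (q * w)" q k] nz unfolding x_def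
    by (simp add: power2_eq_square mult_ac)
  moreover have "(1 - 1 / (q * w)) * (1 - 1 / w) = (q * w - 1) * (w - 1) / (q * w * w)"
    "(1 - x / (q * w)) * (1 - x / w) = (q * w - x) * (w - x) / (q * w * w)"
    using nz by (auto simp: field_simps)
  ultimately have "(q * w - 1) * (w - 1) / (q * w * w) * qpoch (q / w) q k
      = qpoch (q / (q ^ 2 * w)) q k * ((q * w - x) * (w - x) / (q * w * w))"
    by simp
  then have s1: "qpoch (q / w) q k
      = qpoch (q / (q ^ 2 * w)) q k * ((q * w - x) * (w - x) / ((q * w - 1) * (w - 1)))"
    using ne nz by (simp add: nonzero_eq_divide_eq mult_ac)
  have "(1 - w) * (1 - q * w) * qpoch (q ^ 2 * w) q k
       = qpoch w q k * ((1 - x * w) * (1 - q * x * w))"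
    using qpoch_shift2[of w q k] unfolding x_def by (simp add: mult_ac)
  moreover have "(1 - w) * (1 - q * w) = (q * w - 1) * (w - 1)"
    by (simp add: algebra_simps)
  ultimately have s2: "qpoch w q k
      = qpoch (q ^ 2 * w) q k * ((q * w - 1) * (w - 1) / ((1 - x * w) * (1 - q * x * w)))"
    using ne by (simp add: nonzero_eq_divide_eq mult_ac)
  have "(1 - a * q * w) * qpoch (a * q * (q ^ 2 * w)) (q ^ 2) k
      = qpoch (a * q * w) (q ^ 2) k * (1 - a * q * w * x ^ 2)"
    using qpoch_shift[of "a * q * w" "q ^ 2" k] unfolding e by (simp add: mult_ac)
  then have s3: "qpoch (a * q * w) (q ^ 2) k
      = qpoch (a * q * (q ^ 2 * w)) (q ^ 2) k * ((1 - a * q * w) / (1 - a * q * w * x ^ 2))"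
    using ne by (simp add: nonzero_eq_divide_eq mult.commute)
  have "(1 - a / w) * qpoch (a * q ^ 2 / w) (q ^ 2) k
      = qpoch (a * q ^ 2 / (q ^ 2 * w)) (q ^ 2) k * (1 - a / w * x ^ 2)"
    using qpoch_shift[of "a / w" "q ^ 2" k] nz unfolding e by simp
  moreover have "1 - a / w = (w - a) / w" "1 - a / w * x ^ 2 = (w - a * x ^ 2) / w"
    using nz by (simp_all add: field_simps)
  ultimately have "(w - a) / w * qpoch (a * q ^ 2 / w) (q ^ 2) k
      = qpoch (a * q ^ 2 / (q ^ 2 * w)) (q ^ 2) k * ((w - a * x ^ 2) / w)"
    by simp
  then have s4: "qpoch (a * q ^ 2 / w) (q ^ 2) k
      = qpoch (a * q ^ 2 / (q ^ 2 * w)) (q ^ 2) k * ((w - a * x ^ 2) / (w - a))"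
    using ne nz by (simp add: nonzero_eq_divide_eq mult_ac)
  have cancel: "P1 * (n1 / p1) * (P2 * (p1 / n2)) * c / (c1 * (P3 * (n3 / n4)) * (P4 * (n5 / n6)) * c2) * t
    = P1 * P2 * c / (c1 * P3 * P4 * c2) * t * (n1 * n4 * n6 / (n2 * n3 * n5))" if "p1 \<noteq> 0"
    for P1 P2 P3 P4 n1 p1 n2 n3 n4 n5 n6 c c1 c2 t :: 'a
    using that by (simp add: mult_ac)
  show ?thesis
    unfolding gr2_factor_def s1 s2 s3 s4
    by (subst cancel) (use ne in \<open>simp_all add: mult_ac\<close>)
qed

text \<open>With \<open>w = q^(2 * m + 1)\<close> this is the certificate for the passage from
  \<open>m\<close> to \<open>m + 1\<close>. As for the first sum, it is attached to the longer
  series.\<close>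

lemma gr2_wz:
  fixes q a d w e x :: "'a::field" and k :: nat and g :: "'a \<Rightarrow> 'a"
  defines "x \<equiv> q ^ k" and "e \<equiv> d / a + a / d"
  defines "g \<equiv> \<lambda>x. - (w*(1-q*w^2)*(1-a*q*w*x^2)*(1-x^2)*(1-x*e+x^2)*(q-a*x))
     / ((1-q*w*e+q^2*w^2)*(1-a*w)*x*(1-x*w)*(1-q*x*w))"
  assumes nz: "q \<noteq> 0" "a \<noteq> 0" "d \<noteq> 0" "w \<noteq> 0"
    and ne: "w \<noteq> 1" "q * w \<noteq> 1" "x * w \<noteq> 1" "q * x * w \<noteq> 1" "w \<noteq> a * x ^ 2" "w \<noteq> a"
       "a * q * w \<noteq> 1" "a * q * w * x ^ 2 \<noteq> 1"
       "a * q * w * (q * x) ^ 2 \<noteq> 1" "(q * x) ^ 2 \<noteq> 1" "a * (q * x) \<noteq> d" "d * (q * x) \<noteq> a" "q * (q * x) * w \<noteq> 1"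
       "a * w \<noteq> 1" "a * (q * w) \<noteq> d" "d * (q * w) \<noteq> a"
  shows "(1 - a * x ^ 3) * gr2_factor q a d (q ^ 2 * w) k
      - (1-w*e+w^2)*(q*w-a)*(1-a*q*w) / ((1-q*w*e+q^2*w^2)*(1-a*w)*(w-a))
          * ((1 - a * x ^ 3) * gr2_factor q a d w k)
    = gr2_factor q a d (q ^ 2 * w) (Suc k) * g (q * x) - gr2_factor q a d (q ^ 2 * w) k * g x"
proof -
  have x: "x \<noteq> 0"
    using nz by (auto simp: x_def)
  have quad: "1 - t * e + t ^ 2 = (1 - a * t / d) * (1 - d * t / a)" for t
    using nz by (simp add: e_def field_simps power2_eq_square)
  have n0: "1-q*w*e+q^2*w^2 \<noteq> 0"
    using ne(15,16) nz quad[of "q * w"] by (simp add: power_mult_distrib divide_eq_1_iff)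
  define D where "D = (1-q*w*e+q^2*w^2)*(1-a*w)*(1-x*w)*(1-q*x*w)*(w-a*x^2)*x"
  have Dx: "D = x*((1-q*w*e+q^2*w^2)*(1-a*w)*(1-x*w)*(1-q*x*w)*(w-a*x^2))"
    by (simp add: D_def mult_ac)
  have D: "D \<noteq> 0"
    unfolding D_def using n0 ne x by auto
  have gx: "g x = - (w*(1-q*w^2)*(1-a*q*w*x^2)*(1-x^2)*(1-x*e+x^2)*(q-a*x)*(w-a*x^2)) / D"
    unfolding g_def D_def using ne by (simp add: mult_ac)
  have r: "(1-w*e+w^2)*(q*w-a)*(1-a*q*w) / ((1-q*w*e+q^2*w^2)*(1-a*w)*(w-a))
      * ((q * w - x) * (w - x) * (1 - a * q * w * x ^ 2) * (w - a)
     / ((1 - x * w) * (1 - q * x * w) * (1 - a * q * w) * (w - a * x ^ 2)))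
     = x * ((1-w*e+w^2)*(q*w-a)*(q*w-x)*(w-x)*(1-a*q*w*x^2)) / D"
    unfolding D_def using ne x by (simp add: mult_ac)
  define \<beta> where "\<beta> = q * (1 - q / (q ^ 2 * w) * x) * (1 - q ^ 2 * w * x) * ((1 - d * x^2) * (1 - a ^ 2 / d * x^2)) * (1 - q * x^2)
      / ((1 - q ^ 2 * x^2) * (1 - a * q * (q ^ 2 * w) * x^2) * (1 - a * q ^ 2 / (q ^ 2 * w) * x^2)
       * ((1 - a * q / d * x) * (1 - d * q / a * x)))"
  have beta: "gr2_factor q a d (q ^ 2 * w) (Suc k) = gr2_factor q a d (q ^ 2 * w) k * \<beta>"
    unfolding gr2_factor_Suc \<beta>_def x_def ..
  have "\<beta> * g (q * x) = - (w*(1-q*w^2)*(q*w-x)*(1-a*e*x^2+a^2*x^4)*(1-q*x^2)*(1-a*x)*(1-x*w)) / D"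
  proof -
    have e1: "(1 - d * x^2) * (1 - a ^ 2 / d * x^2) = 1 - a * e * x^2 + a^2 * x^4"
      using nz by (simp add: e_def field_simps power2_eq_square power4_eq_xxxx)
    have e2: "1 - q / (q ^ 2 * w) * x = (q * w - x) / (q * w)"
      using nz by (simp add: field_simps power2_eq_square)
    have e3: "(1 - a * q / d * x) * (1 - d * q / a * x) = 1 - q * x * e + (q * x) ^ 2"
      unfolding quad by (simp add: mult_ac)
    have e4: "1 - q ^ 2 * w * x = 1 - q * (q * x) * w" "1 - q ^ 2 * x ^ 2 = 1 - (q * x) ^ 2"
       "1 - a * q * (q ^ 2 * w) * x^2 = 1 - a * q * w * (q * x) ^ 2"
      by (simp_all add: power2_eq_square mult_ac)
    have e5: "1 - a * q ^ 2 / (q ^ 2 * w) * x^2 = (w - a * x ^ 2) / w"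
      using nz by (simp add: field_simps)
    have e6: "q - a * (q * x) = q * (1 - a * x)"
      by (simp add: algebra_simps)
    have "1 - q * x * e + (q * x) ^ 2 \<noteq> 0"
      unfolding quad using ne(11,12) nz by (simp add: divide_eq_1_iff)
    then have n3: "1 - (q * x) ^ 2 \<noteq> 0" "1 - a * q * w * (q * x) ^ 2 \<noteq> 0" "1 - q * x * e + (q * x) ^ 2 \<noteq> 0"
      "1 - q * (q * x) * w \<noteq> 0"
      using ne by auto
    have cancel: "q*(c1/(q*w))*p6*c2*c3/(p2*p1*(c7/w)*p3) * (-(c*p1*p2*p3*(q*a1))/(c4*c5*(q*x)*c6*p6))
       = -(c*c1*c2*c3*a1)/(c4*c5*x*c6*c7)"
      if "p2 \<noteq> 0" "p1 \<noteq> 0" "p3 \<noteq> 0" "p6 \<noteq> 0"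
      for c1 p6 c2 c3 p2 p1 c7 p3 c a1 c4 c5 c6
      using that nz x by (simp add: mult_ac)
    have "\<beta> * g (q * x) = -(w*(1-q*w^2)*(q*w-x)*(1-a*e*x^2+a^2*x^4)*(1-q*x^2)*(1-a*x))
        / ((1-q*w*e+q^2*w^2)*(1-a*w)*x*(1-q*x*w)*(w-a*x^2))"
      unfolding g_def \<beta>_def e1 e2 e3 e4 e5 e6 cancel[OF n3] ..
    then show ?thesis
      unfolding D_def using ne(3) by (simp add: mult_ac)
  qed
  then have "gr2_factor q a d (q ^ 2 * w) (Suc k) * g (q * x) - gr2_factor q a d (q ^ 2 * w) k * g x
     = gr2_factor q a d (q ^ 2 * w) k * ((w*(1-q*w^2)*(1-a*q*w*x^2)*(1-x^2)*(1-x*e+x^2)*(q-a*x)*(w-a*x^2)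
     - w*(1-q*w^2)*(q*w-x)*(1-a*e*x^2+a^2*x^4)*(1-q*x^2)*(1-a*x)*(1-x*w)) / D)"
    unfolding beta gx by (simp add: diff_divide_distrib right_diff_distrib mult.assoc)
  also have "\<dots> = gr2_factor q a d (q ^ 2 * w) k * ((1-a*x^3) * (D - x * ((1-w*e+w^2)*(q*w-a)*(q*w-x)*(w-x)*(1-a*q*w*x^2))) / D)"
    unfolding gr2_wz_identity[symmetric] by (simp only: Dx right_diff_distrib[symmetric] mult.assoc)
  also have "\<dots> = gr2_factor q a d (q ^ 2 * w) k * ((1-a*x^3) * (1 - x * ((1-w*e+w^2)*(q*w-a)*(q*w-x)*(w-x)*(1-a*q*w*x^2)) / D))"
    using D by (simp add: diff_divide_distrib right_diff_distrib)
  finally have eq: "gr2_factor q a d (q ^ 2 * w) (Suc k) * g (q * x) - gr2_factor q a d (q ^ 2 * w) k * g x = \<dots>" .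
  have alg: "gr2_factor q a d (q ^ 2 * w) k * ((1-a*x^3) * (1 - p * r)) = (1-a*x^3) * gr2_factor q a d (q ^ 2 * w) k
      - p * ((1-a*x^3) * (gr2_factor q a d (q ^ 2 * w) k * r))" for p r
    by (simp add: algebra_simps)
  show ?thesis
    using eq
    unfolding gr2_factor_shift[OF nz ne(1-8)[unfolded x_def], folded x_def] r[symmetric] alg
    by (rule sym)
qed

lemma gr2_step:
  fixes q a d :: "'a::field" and m :: nat
  assumes nz: "q \<noteq> 0" "a \<noteq> 0" "d \<noteq> 0"
    and q: "\<And>j. j > 0 \<Longrightarrow> q ^ j \<noteq> 1"
    and a: "\<And>j. j > 0 \<Longrightarrow> a * q ^ j \<noteq> 1" "\<And>j. j > 0 \<Longrightarrow> q ^ j \<noteq> a" "a \<noteq> 1"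
    and d: "\<And>j. j > 0 \<Longrightarrow> a * q ^ j \<noteq> d" "\<And>j. j > 0 \<Longrightarrow> d * q ^ j \<noteq> a"
  shows "(\<Sum>k\<le>2 * Suc m. (1 - a * q ^ (3 * k)) * gr2_factor q a d (q ^ (2 * Suc m + 1)) k)
    = (1 - d * q / a * q ^ (2 * m)) * (1 - a * q / d * q ^ (2 * m)) * (1 - a * q ^ 2 * q ^ (2 * m)) * (1 - q ^ 2 / a * q ^ (2 * m))
      / ((1 - a * q ^ 2 / d * q ^ (2 * m)) * (1 - d * q ^ 2 / a * q ^ (2 * m)) * (1 - a * q * q ^ (2 * m)) * (1 - q / a * q ^ (2 * m)))
      * (\<Sum>k\<le>2 * m. (1 - a * q ^ (3 * k)) * gr2_factor q a d (q ^ (2 * m + 1)) k)"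
proof -
  define y where "y = q ^ (2 * m)"
  define w where "w = q * y"
  define e where "e = d / a + a / d"
  define g where "g = (\<lambda>x. - (w*(1-q*w^2)*(1-a*q*w*x^2)*(1-x^2)*(1-x*e+x^2)*(q-a*x))
     / ((1-q*w*e+q^2*w^2)*(1-a*w)*x*(1-x*w)*(1-q*x*w)))"
  define \<rho> where "\<rho> = (1-w*e+w^2)*(q*w-a)*(1-a*q*w) / ((1-q*w*e+q^2*w^2)*(1-a*w)*(w-a))"
  have wm: "w = q ^ (2 * m + 1)" and ww: "q ^ 2 * w = q ^ (2 * Suc m + 1)"
    by (simp_all add: w_def y_def power2_eq_square mult.assoc)
  have w: "w \<noteq> 0" using nz by (simp add: wm)
  \<comment> \<open>Serves to show \<open>w \<noteq> a * x^2\<close>, where the exponents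
    \<open>2 * m + 1\<close> and \<open>2 * k\<close> differ by parity.\<close>
  have qa: "q ^ i \<noteq> a * q ^ j" if "i \<noteq> j" for i j
  proof (cases "i < j")
    case True
    then have "q ^ j = q ^ i * q ^ (j - i)"
      by (simp flip: power_add)
    then show ?thesis
      using a(1)[of "j - i"] nz True by (simp add: mult.left_commute)
  next
    case False
    then have "q ^ i = q ^ j * q ^ (i - j)"
      by (simp flip: power_add)
    then show ?thesis
      using a(2)[of "i - j"] nz that False by (simp add: mult.commute)
  qed
  have step: "(1 - a * (q ^ k) ^ 3) * gr2_factor q a d (q ^ 2 * w) k - \<rho> * ((1 - a * (q ^ k) ^ 3) * gr2_factor q a d w k)
      = gr2_factor q a d (q ^ 2 * w) (Suc k) * g (q ^ Suc k) - gr2_factor q a d (q ^ 2 * w) k * g (q ^ k)" for k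
  proof -
    have pe: "q ^ (2 * j) = q ^ j * q ^ j" "q ^ (j * 2) = q ^ j * q ^ j" for j
      by (metis mult_2 power_add, metis mult_2_right power_add)
    note ps = pe power_add power2_eq_square power3_eq_cube mult_ac
    note pos = add_gr_0 zero_less_numeral zero_less_one simp_thms
    have "w \<noteq> 1" "q * w \<noteq> 1"
      using q[of "2 * m + 1"] q[of "2 * m + 2"] by (simp_all add: wm)
    moreover have "q ^ k * w = q ^ (2 * m + 1 + k)" "q * q ^ k * w = q ^ (2 * m + 2 + k)"
        "q * (q * q ^ k) * w = q ^ (2 * m + 3 + k)"
      by (simp_all add: wm ps)
    then have "q ^ k * w \<noteq> 1" "q * q ^ k * w \<noteq> 1" "q * (q * q ^ k) * w \<noteq> 1"
      using q[of "2 * m + 1 + k"] q[of "2 * m + 2 + k"] q[of "2 * m + 3 + k"]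
      by (simp_all only: pos)
    moreover have "2 * m + 1 \<noteq> 2 * k"
      using odd_two_times_div_two_succ by (metis dvd_triv_left even_plus_one_iff)
    then have "q ^ (2 * m + 1) \<noteq> a * q ^ (2 * k)"
      by (rule qa)
    then have "w \<noteq> a * (q ^ k) ^ 2"
      unfolding wm pe by (simp only: power2_eq_square not_False_eq_True)
    moreover have "w \<noteq> a"
      using a(2)[of "2 * m + 1"] by (simp add: wm)
    moreover have "a * q * w = a * q ^ (2 * m + 2)"
      by (simp add: wm)
    then have "a * q * w \<noteq> 1"
      using a(1)[of "2 * m + 2"] by (simp only: pos)
    moreover have "a * q * w * (q ^ k) ^ 2 = a * q ^ (2 * m + 2 + 2 * k)"
      "a * q * w * (q * q ^ k) ^ 2 = a * q ^ (2 * m + 4 + 2 * k)"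
      by (simp_all add: wm ps power4_eq_xxxx)
    then have "a * q * w * (q ^ k) ^ 2 \<noteq> 1" "a * q * w * (q * q ^ k) ^ 2 \<noteq> 1"
      using a(1)[of "2 * m + 2 + 2 * k"] a(1)[of "2 * m + 4 + 2 * k"] by (simp_all only: pos)
    moreover have "(q * q ^ k) ^ 2 = q ^ (2 * k + 2)"
      by (simp add: ps)
    then have "(q * q ^ k) ^ 2 \<noteq> 1"
      using q[of "2 * k + 2"] by auto
    moreover have "a * (q * q ^ k) \<noteq> d" "d * (q * q ^ k) \<noteq> a"
      using d(1)[of "Suc k"] d(2)[of "Suc k"] by simp_all
    moreover have "a * w \<noteq> 1" "a * (q * w) \<noteq> d" "d * (q * w) \<noteq> a"
      using a(1)[of "2 * m + 1"] d(1)[of "2 * m + 2"] d(2)[of "2 * m + 2"] by (simp_all add: wm)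
    ultimately show ?thesis
      unfolding \<rho>_def g_def e_def power_Suc by (intro gr2_wz nz w)
  qed
  have "(\<Sum>k\<le>2 * Suc m. (1 - a * q ^ (3 * k)) * gr2_factor q a d (q ^ 2 * w) k) - \<rho> * (\<Sum>k\<le>2 * Suc m. (1 - a * q ^ (3 * k)) * gr2_factor q a d w k)
     = (\<Sum>k\<le>2 * Suc m. gr2_factor q a d (q ^ 2 * w) (Suc k) * g (q ^ Suc k) - gr2_factor q a d (q ^ 2 * w) k * g (q ^ k))"
    unfolding sum_distrib_left sum_subtractf[symmetric]
    by (rule sum.cong) (simp_all only: step[symmetric] mult.commute[of 3] power_mult)
  also have "\<dots> = gr2_factor q a d (q ^ 2 * w) (Suc (2 * Suc m)) * g (q ^ Suc (2 * Suc m)) - gr2_factor q a d (q ^ 2 * w) 0 * g (q ^ 0)"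
    by (rule sum_telescope_Suc)
  also have "gr2_factor q a d (q ^ 2 * w) (Suc (2 * Suc m)) = 0"
    unfolding gr2_factor_def using nz by (subst qpoch_eq_0[of "q / (q ^ 2 * w)" _ "2 * Suc m"]) (simp_all add: ww)
  also have "g (q ^ 0) = 0" by (simp add: g_def)
  finally have "(\<Sum>k\<le>2 * Suc m. (1 - a * q ^ (3 * k)) * gr2_factor q a d (q ^ 2 * w) k)
      = \<rho> * (\<Sum>k\<le>2 * Suc m. (1 - a * q ^ (3 * k)) * gr2_factor q a d w k)"
    by simp
  \<comment> \<open>The series for \<open>w\<close> ends at \<open>2 * m\<close>, so its two extra
    terms up to \<open>2 * m + 2\<close> are zero.\<close>
  also have "gr2_factor q a d w k = 0" if "k > 2 * m" for k
    unfolding gr2_factor_def using nz that by (subst qpoch_eq_0[of "q / w" _ "2 * m"]) (simp_all add: wm)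
  then have "(\<Sum>k\<le>2 * Suc m. (1 - a * q ^ (3 * k)) * gr2_factor q a d w k) = (\<Sum>k\<le>2 * m. (1 - a * q ^ (3 * k)) * gr2_factor q a d w k)"
    by simp
  also have "\<rho> = (1 - d * q / a * y) * (1 - a * q / d * y) * (1 - a * q ^ 2 * y) * (1 - q ^ 2 / a * y)
      / ((1 - a * q ^ 2 / d * y) * (1 - d * q ^ 2 / a * y) * (1 - a * q * y) * (1 - q / a * y))"
  proof -
    have quad: "1 - t * e + t ^ 2 = (1 - a * t / d) * (1 - d * t / a)" for t
      using nz by (simp add: e_def field_simps power2_eq_square)
    have n: "1 - w * e + w ^ 2 = (1 - d * q / a * y) * (1 - a * q / d * y)"
      "1 - q * w * e + q ^ 2 * w ^ 2 = (1 - a * q ^ 2 / d * y) * (1 - d * q ^ 2 / a * y)"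
      using quad[of w] quad[of "q * w"] by (simp_all add: w_def power2_eq_square mult_ac)
    have "(q * w - a) = - a * (1 - q ^ 2 / a * y)" "w - a = - a * (1 - q / a * y)"
      using nz by (simp_all add: w_def field_simps power2_eq_square)
    then show ?thesis
      using nz unfolding \<rho>_def n by (simp add: w_def power2_eq_square mult_ac)
  qed
  finally show ?thesis
    unfolding ww unfolding wm y_def by simp
qed

lemma gasper_rahman_quadratic_sum2:
  fixes q a d :: "'a::field" and m :: nat
  assumes nz: "q \<noteq> 0" "a \<noteq> 0" "d \<noteq> 0"
    and q: "\<And>j. j > 0 \<Longrightarrow> q ^ j \<noteq> 1"
    and a: "\<And>j. j > 0 \<Longrightarrow> a * q ^ j \<noteq> 1" "\<And>j. j > 0 \<Longrightarrow> q ^ j \<noteq> a" "a \<noteq> 1"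
    and d: "\<And>j. j > 0 \<Longrightarrow> a * q ^ j \<noteq> d" "\<And>j. j > 0 \<Longrightarrow> d * q ^ j \<noteq> a"
  shows "(\<Sum>k\<le>2 * m. (1 - a * q ^ (3 * k)) * gr2_factor q a d (q ^ (2 * m + 1)) k)
    = (1 - a) * (qpoch (d * q / a) (q ^ 2) m * qpoch (a * q / d) (q ^ 2) m * qpoch (a * q ^ 2) (q ^ 2) m * qpoch (q ^ 2 / a) (q ^ 2) m
     / (qpoch (a * q ^ 2 / d) (q ^ 2) m * qpoch (d * q ^ 2 / a) (q ^ 2) m * qpoch (a * q) (q ^ 2) m * qpoch (q / a) (q ^ 2) m))"
proof (induction m)
  case 0
  show ?case by (simp add: gr2_factor_def)
next
  case (Suc m)
  have e: "(q ^ 2) ^ m = q ^ (2 * m)"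
    by (simp add: power_mult)
  show ?case
    apply (subst gr2_step[OF assms], assumption+)
    unfolding Suc.IH unfolding e qpoch_Suc by (simp add: mult_ac)
qed

subsection \<open>Values of rational functions at places\<close>

definition place :: "('r::idom \<Rightarrow> 'k::field) \<Rightarrow> bool" where
  "place \<phi> \<longleftrightarrow> \<phi> 1 = 1 \<and> (\<forall>x y. \<phi> (x + y) = \<phi> x + \<phi> y) \<and> (\<forall>x y. \<phi> (x * y) = \<phi> x * \<phi> y)"

lemma place_add: "place \<phi> \<Longrightarrow> \<phi> (x + y) = \<phi> x + \<phi> y"
  and place_mult: "place \<phi> \<Longrightarrow> \<phi> (x * y) = \<phi> x * \<phi> y"
  and place_1: "place \<phi> \<Longrightarrow> \<phi> 1 = 1"
  by (simp_all add: place_def)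

lemma place_0: "place \<phi> \<Longrightarrow> \<phi> 0 = 0"
  using place_add[of \<phi> 0 0] by (metis add_0_right add_cancel_right_right)

lemma place_minus: "place \<phi> \<Longrightarrow> \<phi> (- x) = - \<phi> x"
  using place_add[of \<phi> x "- x"] place_0[of \<phi>] by (simp add: eq_neg_iff_add_eq_0 add.commute)

lemma place_diff: "place \<phi> \<Longrightarrow> \<phi> (x - y) = \<phi> x - \<phi> y"
  using place_add[of \<phi> x "- y"] place_minus[of \<phi> y] by simp

lemma place_sum: "place \<phi> \<Longrightarrow> \<phi> (sum f A) = (\<Sum>i\<in>A. \<phi> (f i))"
  by (induction A rule: infinite_finite_induct) (simp_all add: place_0 place_add)

lemma place_power: "place \<phi> \<Longrightarrow> \<phi> (x ^ n) = \<phi> x ^ n"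
  by (induction n) (simp_all add: place_1 place_mult)

lemma place_to_fract: "place to_fract"
  by (simp add: place_def)

lemma place_of_rat: "place (of_rat :: rat \<Rightarrow> 'a::field_char_0)"
  by (simp add: place_def of_rat_add of_rat_mult)

lemma map_poly_place_add:
  assumes "place \<phi>"
  shows "map_poly \<phi> (p + q) = map_poly \<phi> p + map_poly \<phi> q"
  by (rule poly_eqI) (simp add: coeff_map_poly place_0[OF assms] place_add[OF assms])

lemma map_poly_place_mult:
  assumes "place \<phi>"
  shows "map_poly \<phi> (p * q) = map_poly \<phi> p * map_poly \<phi> q"
  by (rule poly_eqI)
    (simp add: coeff_map_poly coeff_mult place_0[OF assms] place_sum[OF assms] place_mult[OF assms])

lemma place_eval:
  assumes "place \<phi>"
  shows "place (\<lambda>p. poly (map_poly \<phi> p) r)"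
  by (simp add: place_def map_poly_place_add[OF assms] map_poly_place_mult[OF assms] place_1[OF assms])

text \<open>Substitutes inside the coefficients and keeps the outer indeterminate; the passage to
  fractions makes the target a field again, so that such maps can be nested.\<close>

lemma place_map_poly:
  assumes "place \<phi>"
  shows "place (\<lambda>p. to_fract (map_poly \<phi> p))"
  by (simp add: place_def map_poly_place_add[OF assms] map_poly_place_mult[OF assms] place_1[OF assms])

text \<open>
  A ring homomorphism into a field extends to those rational functions that have a representation
  whose denominator is not in the kernel.
\<close>

definition has_value :: "('r::idom \<Rightarrow> 'k::field) \<Rightarrow> 'r fract \<Rightarrow> 'k \<Rightarrow> bool" where
  "has_value \<phi> f v \<longleftrightarrow> (\<exists>N D. \<phi> D \<noteq> 0 \<and> f = to_fract N / to_fract D \<and> v = \<phi> N / \<phi> D)"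

lemma has_valueI:
  "\<phi> D \<noteq> 0 \<Longrightarrow> f = to_fract N / to_fract D \<Longrightarrow> v = \<phi> N / \<phi> D \<Longrightarrow> has_value \<phi> f v"
  by (auto simp: has_value_def)

context
  fixes \<phi> :: "'r::idom \<Rightarrow> 'k::field"
  assumes place: "place \<phi>"
begin

lemma has_value_nonzero: "\<phi> D \<noteq> 0 \<Longrightarrow> to_fract D \<noteq> 0"
  using place_0[OF place] by auto

lemma has_value_to_fract: "has_value \<phi> (to_fract p) (\<phi> p)"
  by (rule has_valueI[of _ 1 _ p]) (simp_all add: place_1[OF place])

lemma has_value_0: "has_value \<phi> 0 0"
  using has_value_to_fract[of 0] by (simp add: place_0[OF place])

lemma has_value_1: "has_value \<phi> 1 1"
  using has_value_to_fract[of 1] by (simp add: place_1[OF place])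

lemma has_value_add:
  assumes "has_value \<phi> f v" "has_value \<phi> g w"
  shows "has_value \<phi> (f + g) (v + w)"
proof -
  obtain N D N' D' where *: "\<phi> D \<noteq> 0" "f = to_fract N / to_fract D" "v = \<phi> N / \<phi> D"
    "\<phi> D' \<noteq> 0" "g = to_fract N' / to_fract D'" "w = \<phi> N' / \<phi> D'"
    using assms unfolding has_value_def by blast
  show ?thesis
    using * has_value_nonzero[of D] has_value_nonzero[of D']
    by (intro has_valueI[of _ "D * D'" _ "N * D' + N' * D"])
      (simp_all add: place_add[OF place] place_mult[OF place] add_frac_eq del: to_fract_eq_0_iff)
qed

lemma has_value_mult:
  assumes "has_value \<phi> f v" "has_value \<phi> g w"
  shows "has_value \<phi> (f * g) (v * w)"
proof -
  obtain N D N' D' where *: "\<phi> D \<noteq> 0" "f = to_fract N / to_fract D" "v = \<phi> N / \<phi> D"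
    "\<phi> D' \<noteq> 0" "g = to_fract N' / to_fract D'" "w = \<phi> N' / \<phi> D'"
    using assms unfolding has_value_def by blast
  show ?thesis
    using * by (intro has_valueI[of _ "D * D'" _ "N * N'"]) (simp_all add: place_mult[OF place])
qed

lemma has_value_minus: "has_value \<phi> f v \<Longrightarrow> has_value \<phi> (- f) (- v)"
  using has_value_mult[OF has_value_to_fract[of "- 1"], of f v]
  by (simp add: place_minus[OF place] place_1[OF place])

lemma has_value_diff: "has_value \<phi> f v \<Longrightarrow> has_value \<phi> g w \<Longrightarrow> has_value \<phi> (f - g) (v - w)"
  using has_value_add[of f v "- g" "- w"] has_value_minus[of g w] by simp

lemma has_value_divide:
  assumes "has_value \<phi> f v" "has_value \<phi> g w" "w \<noteq> 0"
  shows "has_value \<phi> (f / g) (v / w)"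
proof -
  obtain N D N' D' where *: "\<phi> D \<noteq> 0" "f = to_fract N / to_fract D" "v = \<phi> N / \<phi> D"
    "\<phi> D' \<noteq> 0" "g = to_fract N' / to_fract D'" "w = \<phi> N' / \<phi> D'"
    using assms unfolding has_value_def by blast
  show ?thesis
    using * assms(3) has_value_nonzero[of D'] 
    by (intro has_valueI[of _ "D * N'" _ "N * D'"]) (simp_all add: place_mult[OF place])
qed

lemma has_value_power: "has_value \<phi> f v \<Longrightarrow> has_value \<phi> (f ^ n) (v ^ n)"
  by (induction n) (simp_all add: has_value_1 has_value_mult)

lemma has_value_sum:
  "(\<And>i. i \<in> A \<Longrightarrow> has_value \<phi> (f i) (v i)) \<Longrightarrow> has_value \<phi> (sum f A) (sum v A)"
  by (induction A rule: infinite_finite_induct) (simp_all add: has_value_0 has_value_add)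

lemma has_value_qpoch:
  "has_value \<phi> x v \<Longrightarrow> has_value \<phi> q z \<Longrightarrow> has_value \<phi> (qpoch x q n) (qpoch v z n)"
  by (induction n) (simp_all add: has_value_1 has_value_mult has_value_diff has_value_power)

text \<open>A denominator in lowest terms divides every other denominator, so it cannot be in the
  kernel if some other one is not. The divisibility assumption expresses that \<open>N\<close> and
  \<open>D\<close> are coprime in a domain that need not have gcds.\<close>

lemma has_value_coprime:
  fixes N D :: 'r
  assumes "has_value \<phi> f v" "f = to_fract N / to_fract D" "D \<noteq> 0"
    and "\<And>x. D dvd N * x \<Longrightarrow> D dvd x"
  shows "\<phi> D \<noteq> 0" "v = \<phi> N / \<phi> D"
proof -
  obtain N' D' where *: "\<phi> D' \<noteq> 0" "f = to_fract N' / to_fract D'" "v = \<phi> N' / \<phi> D'"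
    using assms(1) unfolding has_value_def by blast
  have "to_fract N / to_fract D = to_fract N' / to_fract D'"
    using assms(2) *(2) by (rule trans[OF sym])
  then have "to_fract (N * D') = to_fract (N' * D)"
    using assms(3) has_value_nonzero[OF *(1)] by (simp add: frac_eq_eq)
  then have eq: "N * D' = N' * D"
    by (simp only: to_fract_eq_iff)
  then have "D dvd N * D'"
    by simp
  then have "D dvd D'"
    by (rule assms(4))
  then show "\<phi> D \<noteq> 0"
    using *(1) by (auto simp: place_mult[OF place])
  have "\<phi> N * \<phi> D' = \<phi> N' * \<phi> D"
    using arg_cong[OF eq, of \<phi>] by (simp only: place_mult[OF place])
  then show "v = \<phi> N / \<phi> D"
    using *(1,3) \<open>\<phi> D \<noteq> 0\<close> by (simp add: frac_eq_eq)
qed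

text \<open>The transfer principle: the two sides of an identity between rational functions may be
  evaluated separately, and the results agree. Cross-multiplication proves it.\<close>

lemma has_value_unique:
  assumes "has_value \<phi> f v" "has_value \<phi> f w"
  shows "v = w"
proof -
  obtain N D N' D' where *: "\<phi> D \<noteq> 0" "f = to_fract N / to_fract D" "v = \<phi> N / \<phi> D"
    "\<phi> D' \<noteq> 0" "f = to_fract N' / to_fract D'" "w = \<phi> N' / \<phi> D'"
    using assms unfolding has_value_def by blast
  have "to_fract N / to_fract D = to_fract N' / to_fract D'"
    using *(2,5) by (rule trans[OF sym])
  then have "to_fract (N * D') = to_fract (N' * D)"
    using has_value_nonzero[OF *(1)] has_value_nonzero[OF *(4)] by (simp add: frac_eq_eq)
  then have "N * D' = N' * D"
    by (simp only: to_fract_eq_iff)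
  then have "\<phi> (N * D') = \<phi> (N' * D)"
    by (simp only:)
  then have "\<phi> N * \<phi> D' = \<phi> N' * \<phi> D"
    by (simp only: place_mult[OF place])
  then show ?thesis
    using *(1,3,4,6) by (simp add: frac_eq_eq)
qed

end

subsection \<open>The sum at powers of q\<close>

definition summand :: "'a::field \<Rightarrow> 'a \<Rightarrow> 'a \<Rightarrow> nat \<Rightarrow> 'a" where
  "summand q a b k = qint q (6 * k + 1)
        * (qpochs [a * q, q / a] (q\<^sup>2) k * qpochs [q\<^sup>2, b * q, q / b] (q ^ 4) k)
        / (qpochs [q ^ 4, q ^ 4 / a, a * q ^ 4] (q ^ 4) k * qpochs [q\<^sup>2 / b, b * q\<^sup>2] (q\<^sup>2) k)
        * q ^ (2 * k)"

definition closed_form :: "'a::field \<Rightarrow> 'a \<Rightarrow> nat \<Rightarrow> 'a" where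
  "closed_form q a m = qpochs [q ^ 5, a * q\<^sup>2, q\<^sup>2 / a] (q ^ 4) m / qpochs [q, q ^ 4 / a, a * q ^ 4] (q ^ 4) m"

text \<open>Reduces the substitution of \<open>q\<close> to the power \<open>-n\<close> to that of
  \<open>q^n\<close>.\<close>

lemma summand_inverse:
  "summand q a (1 / b) k = summand q a b k" "summand q (1 / a) b k = summand q a b k"
  by (simp_all add: summand_def mult_ac)

lemma qpoch_quotient:
  fixes q x :: "'a::field"
  assumes "\<And>j. x * q ^ j \<noteq> 1"
  shows "(1 - x) * (qpoch (x * q) q m / qpoch x q m) = 1 - x * q ^ m"
  using qpoch_nonzero[of m x q] assms qpoch_shift[of x q m] by (simp add: field_simps)

locale generic =
  fixes q :: "'a::field"
  assumes q0: "q \<noteq> 0" and q1: "\<And>j. j > 0 \<Longrightarrow> q ^ j \<noteq> 1"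
begin

lemma pow_eq_iff: "q ^ i = q ^ j \<longleftrightarrow> i = j"
proof -
  have "i \<ge> j" if "q ^ i = q ^ j" for i j
  proof (rule ccontr)
    assume "\<not> i \<ge> j"
    then have "q ^ j = q ^ i * q ^ (j - i)"
      by (simp flip: power_add)
    then show False
      using that q1[of "j - i"] q0 \<open>\<not> i \<ge> j\<close> by simp
  qed
  then show ?thesis
    by (metis order_antisym)
qed

text \<open>The quotient of \<open>(q^5;q^4)_m\<close> by \<open>(q;q^4)_m\<close> telescopes. For
  \<open>n = 4 * m + 1\<close> it is the q-integer of \<open>n\<close>, the factor that makes the
  right-hand side vanish at roots of unity.\<close>

lemma closed_form_eq:
  "(1 - q) * closed_form q a m = (1 - q ^ (4 * m + 1)) * (qpoch (a * q ^ 2) (q ^ 4) m * qpoch (q ^ 2 / a) (q ^ 4) m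
     / (qpoch (q ^ 4 / a) (q ^ 4) m * qpoch (a * q ^ 4) (q ^ 4) m))"
proof -
  have "q * (q ^ 4) ^ j \<noteq> 1" for j
    using q1[of "4 * j + 1"] by (simp add: power_mult)
  then have "(1 - q) * (qpoch (q * q ^ 4) (q ^ 4) m / qpoch q (q ^ 4) m) = 1 - q * (q ^ 4) ^ m"
    by (rule qpoch_quotient)
  moreover have "q * q ^ 4 = q ^ 5"
    by (simp flip: power_Suc)
  moreover have "q * (q ^ 4) ^ m = q ^ (4 * m + 1)"
    by (simp add: power_mult)
  moreover have "(1 - q) * closed_form q a m = ((1 - q) * (qpoch (q ^ 5) (q ^ 4) m / qpoch q (q ^ 4) m))
     * (qpoch (a * q ^ 2) (q ^ 4) m * qpoch (q ^ 2 / a) (q ^ 4) m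
     / (qpoch (q ^ 4 / a) (q ^ 4) m * qpoch (a * q ^ 4) (q ^ 4) m))"
    unfolding closed_form_def by (simp add: mult_ac)
  ultimately show ?thesis
    by simp
qed

text \<open>The first summation formula in base \<open>q^2\<close> with parameters \<open>q\<close>,
  \<open>a * q\<close>, \<open>q^2\<close> and \<open>y = q^(4 * m) = b / q\<close>. Its terminating
  parameter \<open>1 / y\<close> is \<open>q / b\<close> in base \<open>q^4\<close>, which ends the
  sum at \<open>m\<close>.\<close>

lemma sum_summand_b:
  assumes a0: "a \<noteq> 0" and a: "\<And>j. a * q ^ j \<noteq> 1" "\<And>j. q ^ j \<noteq> a"
    and b: "b = q ^ (4 * m + 1)" and "m \<le> M"
  shows "(\<Sum>k=0..M. summand q a b k) = closed_form q a m"
proof -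
  have qQ: "q ^ (2 * j + i) = q ^ i * (q ^ 2) ^ j" for i j
    unfolding power_add power_mult by (rule mult.commute)
  have b0: "b \<noteq> 0" using q0 b by simp
  have gr: "(1 - q * (q ^ 2) ^ (3 * k)) * gr_factor (q ^ 2) q (a * q) (q ^ 2) ((q ^ 2) ^ (2 * m)) k
     = (1 - q) * summand q a b k" for k
  proof -
    have y: "(q ^ 2) ^ (2 * m) = b / q"
      using q0 by (simp add: b flip: power_mult)
    \<comment> \<open>With the third parameter equal to \<open>q^2\<close>, the factorial
      \<open>(q;q^2)_k\<close> stands both above and below. It is absent from \<open>summand\<close>
      and may be cancelled because it is nonzero.\<close>
    have "q * (q ^ 2) ^ j \<noteq> 1" for j
      using q1[of "2 * j + 1"] by (simp only: qQ) simp
    then have nz: "qpoch q (q ^ 2) k \<noteq> 0"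
      by (intro qpoch_nonzero)
    have sq: "(q ^ 2) ^ 2 = q ^ 4"
      by simp
    have args: "q ^ 2 / (a * q) = q / a" "1 / (b / q) = q / b" "q ^ 2 * q ^ 2 * (b / q) / q ^ 2 = b * q"
      "q * q ^ 4 / (a * q) = q ^ 4 / a" "q * (a * q) * q ^ 2 = a * q ^ 4" "q * q ^ 2 / q ^ 2 = q"
      "q ^ 2 / (q * (b / q)) = q ^ 2 / b" "q * q ^ 2 * (b / q) = b * q ^ 2"
      using q0 a0 b0 by (simp_all add: field_simps power2_eq_square power4_eq_xxxx)
    have "1 - q \<noteq> 0" using q1[of 1] by simp
    then show ?thesis
      using nz q0
      unfolding gr_factor_def summand_def y sq args qint_def
      by (simp add: mult_ac power_mult[symmetric] flip: power_Suc)
  qed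
  have "(1 - q) * (\<Sum>k\<le>m. summand q a b k)
    = (\<Sum>k\<le>m. (1 - q * (q ^ 2) ^ (3 * k)) * gr_factor (q ^ 2) q (a * q) (q ^ 2) ((q ^ 2) ^ (2 * m)) k)"
    unfolding gr sum_distrib_left ..
  also have "\<dots> = (1 - q) * (qpoch (q * q ^ 2) (q ^ 2) (2 * m) * (qpoch (q * (q ^ 2) ^ 2 / (a * q * q ^ 2)) ((q ^ 2) ^ 2) m
        * qpoch (q * (a * q) * q ^ 2 / q ^ 2) ((q ^ 2) ^ 2) m)
      / (qpoch (q * q ^ 2 / q ^ 2) (q ^ 2) (2 * m) * (qpoch (q * (q ^ 2) ^ 2 / (a * q)) ((q ^ 2) ^ 2) m
        * qpoch (q * (a * q) * q ^ 2) ((q ^ 2) ^ 2) m)))"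
  proof (rule gasper_rahman_quadratic_sum)
    fix j :: nat
    show "q * (q ^ 2) ^ j \<noteq> q ^ 2"
      using pow_eq_iff[of "2 * j + 1" 2] unfolding qQ by simp
    assume "j > 0"
    show "(q ^ 2) ^ j \<noteq> 1"
      using q1[of "2 * j"] \<open>j > 0\<close> by (simp add: power_mult)
    show "q * (q ^ 2) ^ j \<noteq> 1"
      using q1[of "2 * j + 1"] unfolding qQ by simp
    show "q ^ 2 * (q ^ 2) ^ j \<noteq> q ^ 2"
      using pow_eq_iff[of "2 * j + 2" 2] \<open>j > 0\<close> unfolding qQ by simp
    show "q * (q ^ 2) ^ j \<noteq> a * q"
      using a(2)[of "2 * j"] q0 by (simp add: power_mult)
    show "q * (a * q) * (q ^ 2) ^ j \<noteq> 1"
      using a(1)[of "2 * j + 2"] unfolding qQ by (simp add: power2_eq_square mult_ac)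
  qed (use q0 a0 in auto)
  also have "\<dots> = (1 - q) * closed_form q a m"
  proof -
    have "q * (q ^ 2) ^ j \<noteq> 1" for j
      using q1[of "2 * j + 1"] by (simp only: qQ) simp
    then have "(1 - q) * (qpoch (q * q ^ 2) (q ^ 2) (2 * m) / qpoch q (q ^ 2) (2 * m)) = 1 - q * (q ^ 2) ^ (2 * m)"
      by (rule qpoch_quotient)
    moreover have "q * (q ^ 2) ^ (2 * m) = q ^ (4 * m + 1)"
      by (simp flip: power_mult)
    moreover have sq: "(q ^ 2) ^ 2 = q ^ 4"
      by simp
    moreover have args: "q * q ^ 4 / (a * q * q ^ 2) = q ^ 2 / a" "q * (a * q) * q ^ 2 / q ^ 2 = a * q ^ 2"
      "q * q ^ 2 / q ^ 2 = q" "q * q ^ 4 / (a * q) = q ^ 4 / a" "q * (a * q) * q ^ 2 = a * q ^ 4"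
      using q0 a0 by (simp_all add: field_simps power2_eq_square power4_eq_xxxx)
    moreover have "(1 - q) * (A * (B * C) / (D * (E * F))) = ((1 - q) * (A / D)) * (C * B / (E * F))" for A B C D E F
      by simp
    ultimately show ?thesis
      unfolding closed_form_eq sq args by (simp only:)
  qed
  finally have "(\<Sum>k\<le>m. summand q a b k) = closed_form q a m"
    using q1[of 1] by simp
  moreover have "summand q a b k = 0" if "k > m" for k
  proof -
    have "q / b * (q ^ 4) ^ m = 1"
      using q0 by (simp add: b power_mult)
    then have "qpoch (q / b) (q ^ 4) k = 0"
      using that by (rule qpoch_eq_0)
    then show ?thesis
      by (simp add: summand_def)
  qed
  then have "(\<Sum>k\<le>m. summand q a b k) = (\<Sum>k=0..M. summand q a b k)"
    using \<open>m \<le> M\<close> by (intro sum.mono_neutral_left) auto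
  ultimately show ?thesis by simp
qed

text \<open>The second summation formula in base \<open>q^2\<close> with parameters
  \<open>q\<close>, \<open>b * q\<close> and \<open>w = a * q\<close>. Now \<open>q / a\<close>
  terminates the sum; its base is \<open>q^2\<close> instead of \<open>q^4\<close>, so the last
  index is \<open>2 * m\<close>.\<close>

lemma sum_summand_a:
  assumes b0: "b \<noteq> 0" and b: "\<And>j. b * q ^ j \<noteq> 1" "\<And>j. q ^ j \<noteq> b"
    and a: "a = q ^ (4 * m + 1)" and "2 * m \<le> M"
  shows "(\<Sum>k=0..M. summand q a b k) = closed_form q b m"
proof -
  have qQ: "q ^ (2 * j + i) = q ^ i * (q ^ 2) ^ j" for i j
    unfolding power_add power_mult by (rule mult.commute)
  have a0: "a \<noteq> 0" using q0 a by simp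
  have gr: "(1 - q * (q ^ 2) ^ (3 * k)) * gr2_factor (q ^ 2) q (b * q) ((q ^ 2) ^ (2 * m + 1)) k
     = (1 - q) * summand q a b k" for k
  proof -
    have w: "(q ^ 2) ^ (2 * m + 1) = a * q"
      unfolding a power_mult[symmetric] by simp
    have sq: "(q ^ 2) ^ 2 = q ^ 4"
      by simp
    have args: "q ^ 2 / (a * q) = q / a" "q ^ 2 / (b * q) = q / b" "q * q ^ 2 * (a * q) = a * q ^ 4"
      "q * q ^ 4 / (a * q) = q ^ 4 / a" "q * q ^ 2 / (b * q) = q ^ 2 / b" "b * q * q ^ 2 / q = b * q ^ 2"
      using q0 a0 b0 by (simp_all add: field_simps power2_eq_square power4_eq_xxxx)
    have "1 - q \<noteq> 0" using q1[of 1] by simp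
    then show ?thesis
      using q0
      unfolding gr2_factor_def summand_def w sq args qint_def
      by (simp add: mult_ac power_mult[symmetric] flip: power_Suc)
  qed
  have "(1 - q) * (\<Sum>k\<le>2 * m. summand q a b k)
    = (\<Sum>k\<le>2 * m. (1 - q * (q ^ 2) ^ (3 * k)) * gr2_factor (q ^ 2) q (b * q) ((q ^ 2) ^ (2 * m + 1)) k)"
    unfolding gr sum_distrib_left ..
  also have "\<dots> = (1 - q) * (qpoch (b * q * q ^ 2 / q) ((q ^ 2) ^ 2) m * qpoch (q * q ^ 2 / (b * q)) ((q ^ 2) ^ 2) m
      * qpoch (q * (q ^ 2) ^ 2) ((q ^ 2) ^ 2) m * qpoch ((q ^ 2) ^ 2 / q) ((q ^ 2) ^ 2) m
     / (qpoch (q * (q ^ 2) ^ 2 / (b * q)) ((q ^ 2) ^ 2) m * qpoch (b * q * (q ^ 2) ^ 2 / q) ((q ^ 2) ^ 2) m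
      * qpoch (q * q ^ 2) ((q ^ 2) ^ 2) m * qpoch (q ^ 2 / q) ((q ^ 2) ^ 2) m))"
  proof (rule gasper_rahman_quadratic_sum2)
    fix j :: nat
    assume "j > 0"
    show "(q ^ 2) ^ j \<noteq> 1"
      using q1[of "2 * j"] \<open>j > 0\<close> by (simp add: power_mult)
    show "q * (q ^ 2) ^ j \<noteq> 1"
      using q1[of "2 * j + 1"] unfolding qQ by simp
    show "(q ^ 2) ^ j \<noteq> q"
      using pow_eq_iff[of "2 * j" 1] by (simp add: power_mult)
    show "q * (q ^ 2) ^ j \<noteq> b * q"
      using b(2)[of "2 * j"] q0 by (simp add: power_mult)
    show "b * q * (q ^ 2) ^ j \<noteq> q"
      using b(1)[of "2 * j"] q0 by (simp add: power_mult)
  qed (use q0 q1[of 1] b0 in auto)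
  also have "\<dots> = (1 - q) * closed_form q b m"
  proof -
    have sq: "(q ^ 2) ^ 2 = q ^ 4"
      by simp
    have args: "b * q * q ^ 2 / q = b * q ^ 2" "q * q ^ 2 / (b * q) = q ^ 2 / b" "q * q ^ 4 = q ^ 5" "q ^ 4 / q = q ^ 3"
      "q * q ^ 4 / (b * q) = q ^ 4 / b" "b * q * q ^ 4 / q = b * q ^ 4" "q * q ^ 2 = q ^ 3" "q ^ 2 / q = q"
      using q0 b0 by (simp_all add: field_simps eval_nat_numeral)
    \<comment> \<open>In this specialisation the numerator parameter \<open>q^2 / a\<close> and the
      denominator parameter \<open>a * q\<close> of the general formula both become
      \<open>q^3\<close> and cancel.\<close>
    have "q ^ 3 * (q ^ 4) ^ j \<noteq> 1" for j
      using q1[of "3 + 4 * j"] by (simp add: power_add power_mult)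
    then have "qpoch (q ^ 3) (q ^ 4) m \<noteq> 0"
      by (rule qpoch_nonzero)
    then show ?thesis
      unfolding closed_form_def sq unfolding args(1,2,4,5,6,8) unfolding args(3,7) by (simp add: mult_ac)
  qed
  finally have "(\<Sum>k\<le>2 * m. summand q a b k) = closed_form q b m"
    using q1[of 1] by simp
  moreover have "summand q a b k = 0" if "k > 2 * m" for k
  proof -
    have "q / a * (q ^ 2) ^ (2 * m) = 1"
      using q0 by (simp add: a flip: power_mult)
    then have "qpoch (q / a) (q ^ 2) k = 0"
      using that by (rule qpoch_eq_0)
    then show ?thesis
      by (simp add: summand_def)
  qed
  then have "(\<Sum>k\<le>2 * m. summand q a b k) = (\<Sum>k=0..M. summand q a b k)"
    using \<open>2 * m \<le> M\<close> by (intro sum.mono_neutral_left) auto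
  ultimately show ?thesis by simp
qed

end

subsection \<open>The sum at roots of unity\<close>

lemma qpoch_add: "qpoch x q (m + k) = qpoch x q m * qpoch (x * q ^ m) q k"
  by (induction k) (simp_all add: power_add mult_ac)

text \<open>
  The parameter \<open>s\<close> stands for \<open>q\<^sup>m\<close> in the passage from the index \<open>m\<close> to \<open>m + k\<close>.
\<close>

definition core :: "'a::field \<Rightarrow> 'a \<Rightarrow> 'a \<Rightarrow> 'a \<Rightarrow> nat \<Rightarrow> 'a" where
  "core q a b s k =
    qpoch (q^2 * s^4) (q^4) k / qpoch (q^4 * s^4) (q^4) k
     * (qpoch (a * q * s^2) (q^2) k * qpoch (q / a * s^2) (q^2) k * (qpoch (b * q * s^4) (q^4) k * qpoch (q / b * s^4) (q^4) k)
      / (qpoch (q^4 / a * s^4) (q^4) k * qpoch (a * q^4 * s^4) (q^4) k * (qpoch (q^2 / b * s^2) (q^2) k * qpoch (b * q^2 * s^2) (q^2) k)))"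

lemma summand_core: "summand q a b k = qint q (6 * k + 1) * core q a b 1 k * q ^ (2 * k)"
  by (simp add: summand_def core_def mult_ac)

text \<open>The source of the block structure: for \<open>m = l * d\<close> the parameter
  \<open>q^m\<close> has value 1 at a root of unity of order \<open>d\<close>, so the second factor
  takes the value of the core with index \<open>k\<close> in the first block.\<close>

lemma core_add: "core q a b 1 (m + k) = core q a b 1 m * core q a b (q ^ m) k"
proof -
  have "(q ^ m) ^ 2 = (q ^ 2) ^ m" "(q ^ m) ^ 4 = (q ^ 4) ^ m"
    by (metis mult.commute power_mult)+
  then show ?thesis
    unfolding core_def qpoch_add by (simp add: mult_ac)
qed

lemma has_value_gr_factor:
  assumes "place \<phi>" "has_value \<phi> q z" "has_value \<phi> a \<alpha>" "has_value \<phi> b \<beta>" "has_value \<phi> d \<delta>" "has_value \<phi> y \<upsilon>"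
    and "\<alpha> \<noteq> 0" "\<beta> \<noteq> 0" "\<delta> \<noteq> 0" "\<upsilon> \<noteq> 0"
    and "qpoch (z ^ 2) (z ^ 2) k \<noteq> 0" "qpoch (\<alpha> * z ^ 2 / \<beta>) (z ^ 2) k \<noteq> 0" "qpoch (\<alpha> * \<beta> * z) (z ^ 2) k \<noteq> 0"
     "qpoch (\<alpha> * z / \<delta>) z k \<noteq> 0" "qpoch (\<delta> / (\<alpha> * \<upsilon>)) z k \<noteq> 0" "qpoch (\<alpha> * z * \<upsilon>) z k \<noteq> 0"
  shows "has_value \<phi> (gr_factor q a b d y k) (gr_factor z \<alpha> \<beta> \<delta> \<upsilon> k)"
  unfolding gr_factor_def
  by (intro has_value_mult has_value_divide has_value_qpoch has_value_power has_value_1 assms)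
    (use assms in simp_all)

lemma has_value_core:
  assumes "place \<phi>" "has_value \<phi> q z" "has_value \<phi> a \<alpha>" "has_value \<phi> b \<beta>" "has_value \<phi> s \<sigma>"
    and "\<alpha> \<noteq> 0" "\<beta> \<noteq> 0"
    and "qpoch (z^4 * \<sigma>^4) (z^4) k \<noteq> 0" "qpoch (z^4 / \<alpha> * \<sigma>^4) (z^4) k \<noteq> 0" "qpoch (\<alpha> * z^4 * \<sigma>^4) (z^4) k \<noteq> 0"
      "qpoch (z^2 / \<beta> * \<sigma>^2) (z^2) k \<noteq> 0" "qpoch (\<beta> * z^2 * \<sigma>^2) (z^2) k \<noteq> 0"
  shows "has_value \<phi> (core q a b s k) (core z \<alpha> \<beta> \<sigma> k)"
  unfolding core_def
  by (intro has_value_mult has_value_divide has_value_qpoch has_value_power assms)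
    (use assms in simp_all)

text \<open>The order is written \<open>2 * h + 1\<close> because it divides an odd
  \<open>n\<close>; oddness lets the factors 2 and 4 be cancelled from exponents modulo the order.
  Characteristic 0 keeps a geometric sum with all terms 1 from vanishing.\<close>

locale root_of_unity =
  fixes z :: "'k::field" and h :: nat
  assumes z1: "z ^ (2 * h + 1) = 1" and h: "h > 0"
    and zi: "\<And>i. 0 < i \<Longrightarrow> i < 2 * h + 1 \<Longrightarrow> z ^ i \<noteq> 1"
    and char_0: "\<And>i. of_nat (Suc i) \<noteq> (0::'k)"
begin

definition "d = 2 * h + 1"

lemma z0: "z \<noteq> 0"
  using z1 by (metis power_0_left one_neq_zero add_is_0 one_neq_zero)

lemma z_pow_mod: "z ^ i = z ^ (i mod d)"
proof -
  have "z ^ i = z ^ (d * (i div d) + i mod d)"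
    by simp
  also have "\<dots> = (z ^ d) ^ (i div d) * z ^ (i mod d)"
    by (simp only: power_add power_mult)
  finally show ?thesis
    using z1 by (simp add: d_def)
qed

lemma z_pow_eq_1: "z ^ i = 1 \<longleftrightarrow> d dvd i"
  using zi[of "i mod d"] z_pow_mod[of i] by (auto simp: d_def dvd_eq_mod_eq_0 intro!: gr0I)

lemma d_dvd_power2: "d dvd 2 * i \<longleftrightarrow> d dvd i"
proof -
  have "coprime d 2" by (simp add: d_def)
  then show ?thesis by (simp add: coprime_dvd_mult_right_iff)
qed

lemma d_dvd_power4: "d dvd 4 * i \<longleftrightarrow> d dvd i"
  using d_dvd_power2[of i] d_dvd_power2[of "2 * i"] by simp

end

text \<open>The rational functions \<open>q\<close>, \<open>a\<close>, \<open>b\<close> have the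
  values \<open>z\<close>, \<open>\<alpha>\<close>, \<open>\<beta>\<close>. Both triples are
  constrained: the summation formula is applied to the first, and its denominators have to survive
  at the second.\<close>

locale root_of_unity_place = root_of_unity z h + generic q
  for z :: "'k::field" and h :: nat and q :: "'r::idom fract" +
  fixes \<phi> :: "'r \<Rightarrow> 'k" and a b :: "'r fract" and \<alpha> \<beta> :: 'k
  assumes place: "place \<phi>"
    and hq: "has_value \<phi> q z" and ha: "has_value \<phi> a \<alpha>" and hb: "has_value \<phi> b \<beta>"
    and ab0: "a \<noteq> 0" "b \<noteq> 0" "\<alpha> \<noteq> 0" "\<beta> \<noteq> 0"
    and ab: "\<And>j. a * q ^ j \<noteq> 1" "\<And>j. q ^ j \<noteq> a" "\<And>j. q ^ j \<noteq> b"
    and \<alpha>: "\<And>j. \<alpha> * z ^ j \<noteq> 1" "\<And>j. z ^ j \<noteq> \<alpha>"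
    and \<beta>: "\<And>j. \<beta> * z ^ j \<noteq> 1" "\<And>j. z ^ j \<noteq> \<beta>"
begin

lemma qpoch_z_nonzero:
  "qpoch (z^4 / \<alpha>) (z^4) k \<noteq> 0" "qpoch (\<alpha> * z^4) (z^4) k \<noteq> 0" 
  "qpoch (z^2 / \<beta>) (z^2) k \<noteq> 0" "qpoch (\<beta> * z^2) (z^2) k \<noteq> 0"
proof -
  have e: "z^4 * (z^4) ^ j = z ^ (4 * Suc j)" "z^2 * (z^2) ^ j = z ^ (2 * Suc j)" for j
    by (simp_all only: power_mult power_Suc)
  have e': "c * z^4 * (z^4) ^ j = c * z ^ (4 * Suc j)" "c * z^2 * (z^2) ^ j = c * z ^ (2 * Suc j)"
      "z^4 / c * (z^4) ^ j = z ^ (4 * Suc j) / c" "z^2 / c * (z^2) ^ j = z ^ (2 * Suc j) / c" for c j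
    unfolding e[symmetric] by simp_all
  show "qpoch (z^4 / \<alpha>) (z^4) k \<noteq> 0" "qpoch (z^2 / \<beta>) (z^2) k \<noteq> 0"
    "qpoch (\<alpha> * z^4) (z^4) k \<noteq> 0" "qpoch (\<beta> * z^2) (z^2) k \<noteq> 0"
    unfolding e' by (rule qpoch_nonzero, unfold e', simp only: divide_eq_1_iff \<alpha> \<beta> ab0 simp_thms)+
qed

lemma qpoch_z4_nonzero: "k < d \<Longrightarrow> qpoch (z^4) (z^4) k \<noteq> 0"
proof (rule qpoch_nonzero)
  fix j assume "k < d" "j < k"
  have "z^4 * (z^4) ^ j = z ^ (4 * Suc j)"
    by (simp only: power_mult power_Suc)
  moreover have "\<not> d dvd Suc j"
    using \<open>k < d\<close> \<open>j < k\<close> by (auto dest: dvd_imp_le)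
  ultimately show "z^4 * (z^4) ^ j \<noteq> 1"
    by (simp only: z_pow_eq_1 d_dvd_power4 not_False_eq_True)
qed

lemma block_half: "(\<Sum>k\<le>h. summand z \<alpha> \<beta> k) = 0"
proof -
  \<comment> \<open>The generic series terminates at \<open>h\<close> for this exponent. At the root
    of unity \<open>y\<close> becomes the inverse of \<open>z^2\<close>, so the terminating
    parameter turns into the \<open>z^2\<close> of the summand.\<close>
  define y where "y = (z ^ 2) ^ (2 * h)"
  have "y * z ^ 2 = (z ^ (2 * h + 1)) ^ 2"
    by (simp add: y_def power_add power_mult_distrib flip: power_mult)
  then have yz: "y * z ^ 2 = 1"
    by (simp only: z1 power_one)
  then have y: "y = 1 / z ^ 2"
    using z0 by (simp add: field_simps)
  have qQ: "x ^ (2 * j + i) = x ^ i * (x ^ 2) ^ j" for i j and x :: "'c::comm_monoid_mult"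
    unfolding power_add power_mult by (rule mult.commute)
  have sq: "(z ^ 2) ^ 2 = z ^ 4" by simp
  have args: "z ^ 2 / (\<alpha> * z) = z / \<alpha>" "1 / (1 / z ^ 2) = z ^ 2" "z ^ 2 * z ^ 2 * (1 / z ^ 2) / (\<beta> * z) = z / \<beta>"
      "z * z ^ 4 / (\<alpha> * z) = z ^ 4 / \<alpha>" "z * (\<alpha> * z) * z ^ 2 = \<alpha> * z ^ 4" "z * z ^ 2 / (\<beta> * z) = z ^ 2 / \<beta>"
      "\<beta> * z / (z * (1 / z ^ 2)) = \<beta> * z ^ 2" "z * z ^ 2 * (1 / z ^ 2) = z"
      using z0 ab0 by (simp_all add: field_simps power2_eq_square power4_eq_xxxx)
  \<comment> \<open>\<open>(z;z^2)_k\<close> has to be cancelled from the specialised series. It is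
    nonzero only up to \<open>k = h\<close>, since the factor with index \<open>h\<close> is
    \<open>1 - z^(2 * h + 1)\<close>.\<close>
  have nz: "qpoch z (z ^ 2) k \<noteq> 0" if "k \<le> h" for k
  proof (rule qpoch_nonzero)
    fix j assume "j < k"
    then have "\<not> d dvd 2 * j + 1"
      using \<open>k \<le> h\<close> by (auto simp: d_def dest: dvd_imp_le)
    then show "z * (z ^ 2) ^ j \<noteq> 1"
      using z_pow_eq_1[of "2 * j + 1"] unfolding qQ by simp
  qed
  have sum_F: "(\<Sum>k\<le>h. (1 - q * (q ^ 2) ^ (3 * k)) * gr_factor (q ^ 2) q (a * q) (b * q) ((q ^ 2) ^ (2 * h)) k)
    = (1 - q) * (qpoch (q * q ^ 2) (q ^ 2) (2 * h) * (qpoch (q * (q ^ 2) ^ 2 / (a * q * (b * q))) ((q ^ 2) ^ 2) h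
        * qpoch (q * (a * q) * q ^ 2 / (b * q)) ((q ^ 2) ^ 2) h)
      / (qpoch (q * q ^ 2 / (b * q)) (q ^ 2) (2 * h) * (qpoch (q * (q ^ 2) ^ 2 / (a * q)) ((q ^ 2) ^ 2) h
        * qpoch (q * (a * q) * q ^ 2) ((q ^ 2) ^ 2) h)))"
  proof (rule gasper_rahman_quadratic_sum)
    fix j :: nat
    show "q * (q ^ 2) ^ j \<noteq> b * q"
      using ab(3)[of "2 * j"] q0 by (simp add: power_mult)
    assume "j > 0"
    show "(q ^ 2) ^ j \<noteq> 1"
      using q1[of "2 * j"] \<open>j > 0\<close> by (simp add: power_mult)
    show "q * (q ^ 2) ^ j \<noteq> 1"
      using q1[of "2 * j + 1"] unfolding qQ by simp
    show "q ^ 2 * (q ^ 2) ^ j \<noteq> b * q"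
      using ab(3)[of "2 * j + 1"] q0 unfolding qQ by (simp add: power2_eq_square mult_ac)
    show "q * (q ^ 2) ^ j \<noteq> a * q"
      using ab(2)[of "2 * j"] q0 by (simp add: power_mult)
    show "q * (a * q) * (q ^ 2) ^ j \<noteq> 1"
      using ab(1)[of "2 * j + 2"] unfolding qQ by (simp add: power2_eq_square mult_ac)
  qed (use q0 ab0 in auto)
  have "has_value \<phi> (\<Sum>k\<le>h. (1 - q * (q ^ 2) ^ (3 * k)) * gr_factor (q ^ 2) q (a * q) (b * q) ((q ^ 2) ^ (2 * h)) k)
     (\<Sum>k\<le>h. (1 - z * (z ^ 2) ^ (3 * k)) * gr_factor (z ^ 2) z (\<alpha> * z) (\<beta> * z) y k)"
    unfolding y_def
    by (intro has_value_sum has_value_mult has_value_diff has_value_1 has_value_power has_value_gr_factor place hq ha hb)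
      (use z0 ab0 nz qpoch_z_nonzero qpoch_z4_nonzero in \<open>simp_all add: y[unfolded y_def] args sq d_def\<close>)
  moreover have "has_value \<phi> (\<Sum>k\<le>h. (1 - q * (q ^ 2) ^ (3 * k)) * gr_factor (q ^ 2) q (a * q) (b * q) ((q ^ 2) ^ (2 * h)) k)
     ((1 - z) * (qpoch (z * z ^ 2) (z ^ 2) (2 * h) * (qpoch (z * (z ^ 2) ^ 2 / (\<alpha> * z * (\<beta> * z))) ((z ^ 2) ^ 2) h
        * qpoch (z * (\<alpha> * z) * z ^ 2 / (\<beta> * z)) ((z ^ 2) ^ 2) h)
      / (qpoch (z * z ^ 2 / (\<beta> * z)) (z ^ 2) (2 * h) * (qpoch (z * (z ^ 2) ^ 2 / (\<alpha> * z)) ((z ^ 2) ^ 2) h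
        * qpoch (z * (\<alpha> * z) * z ^ 2) ((z ^ 2) ^ 2) h))))"
    unfolding sum_F
    by (intro has_value_mult has_value_divide has_value_diff has_value_qpoch has_value_1 has_value_power place hq ha hb)
      (use z0 ab0 qpoch_z_nonzero in \<open>simp_all add: args sq\<close>)
  \<comment> \<open>The vanishing factor has index \<open>h - 1\<close>, namely
    \<open>1 - z^3 * z^(2 * h - 2) = 1 - z^(2 * h + 1)\<close>; it exists because
    \<open>h > 0\<close>.\<close>
  moreover have "qpoch (z * z ^ 2) (z ^ 2) (2 * h) = 0"
  proof (rule qpoch_eq_0)
    have "z * z ^ 2 * (z ^ 2) ^ (h - 1) = z * (z ^ 2) ^ Suc (h - 1)"
      by simp
    also have "\<dots> = z ^ (2 * h + 1)"
      using h unfolding qQ by simp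
    finally show "z * z ^ 2 * (z ^ 2) ^ (h - 1) = 1"
      by (simp only: z1)
  qed (use h in simp)
  ultimately have "(\<Sum>k\<le>h. (1 - z * (z ^ 2) ^ (3 * k)) * gr_factor (z ^ 2) z (\<alpha> * z) (\<beta> * z) y k) = 0"
    using has_value_unique[OF place] by fastforce
  moreover have "(1 - z * (z ^ 2) ^ (3 * k)) * gr_factor (z ^ 2) z (\<alpha> * z) (\<beta> * z) y k = (1 - z) * summand z \<alpha> \<beta> k" if "k \<le> h" for k
  proof -
    have "1 - z \<noteq> 0" using zi[of 1] h by simp
    then show ?thesis
      using nz[OF that] z0
      unfolding gr_factor_def summand_def y sq args qint_def
      by (simp add: mult_ac power_mult[symmetric] flip: power_Suc)
  qed
  ultimately have "(1 - z) * (\<Sum>k\<le>h. summand z \<alpha> \<beta> k) = 0"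
    by (simp add: sum_distrib_left)
  then show ?thesis
    using zi[of 1] h by simp
qed

text \<open>The factor with index \<open>h\<close> of \<open>(z^2;z^4)_k\<close> is
  \<open>1 - z^(2 * d)\<close>. So only the first half of a block contributes, which is why a block
  may be cut after index \<open>h\<close>.\<close>

lemma summand_z_eq_0: "h < k \<Longrightarrow> summand z \<alpha> \<beta> k = 0"
proof -
  assume "h < k"
  have "z ^ 2 * (z ^ 4) ^ h = (z ^ (2 * h + 1)) ^ 2"
    by (simp add: power_add power_mult_distrib mult.commute flip: power_mult)
  then have "qpoch (z ^ 2) (z ^ 4) k = 0"
    using \<open>h < k\<close> by (intro qpoch_eq_0[of _ _ h]) (simp_all only: z1 power_one)
  then show ?thesis
    by (simp add: summand_def)
qed

end

section \<open>Decomposition of the sum into blocks of length \<open>d\<close>\<close>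

lemma sum_lessThan_add:
  fixes f :: "nat \<Rightarrow> 'a::comm_monoid_add"
  shows "(\<Sum>k<m + n. f k) = (\<Sum>k<m. f k) + (\<Sum>k<n. f (m + k))"
  by (induction n) (simp_all add: add.assoc)

context root_of_unity_place begin

lemma has_value_q_pow: "has_value \<phi> (q ^ (l * d)) 1"
proof -
  have "z ^ (l * d) = 1"
    by (simp add: z_pow_eq_1)
  then show ?thesis
    using has_value_power[OF place hq, of "l * d"] by simp
qed

lemma has_value_core_block:
  assumes "r < d"
  shows "has_value \<phi> (core q a b (q ^ (l * d)) r) (core z \<alpha> \<beta> 1 r)"
  by (intro has_value_core place hq ha hb has_value_q_pow ab0)
    (use qpoch_z_nonzero qpoch_z4_nonzero[OF assms] in simp_all)

text \<open>The factor \<open>1 - q\<^sup>4\<^sup>k\<close> with \<open>k = (l + 1) d\<close> of the denominator vanishes at a root of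
  unity of order \<open>d\<close>; it is compensated by the factor with index \<open>h = (d - 1) / 2\<close> of the numerator.\<close>

lemma has_value_core_full_block: "\<exists>w. has_value \<phi> (core q a b (q ^ (l * d)) d) w"
proof -
  define s where "s = q ^ (l * d)"
  have s: "has_value \<phi> s 1"
    unfolding s_def by (rule has_value_q_pow)
  define Q where "Q = q ^ (2 * d)"
  have "has_value \<phi> Q (z ^ (2 * d))"
    unfolding Q_def by (rule has_value_power[OF place hq])
  then have Q: "has_value \<phi> Q 1"
    using z_pow_eq_1[of "2 * d"] by simp
  have top: "q^2 * s^4 * (q^4) ^ h = Q ^ Suc (2 * l)"
  proof -
    have "2 + l * d * 4 + 4 * h = 2 * d * Suc (2 * l)"
      by (simp add: d_def algebra_simps)
    then show ?thesis
      unfolding s_def Q_def by (simp only: power_mult[symmetric] power_add[symmetric])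
  qed
  have bot: "q^4 * s^4 * (q^4) ^ (2 * h) = Q ^ Suc (Suc (2 * l))"
  proof -
    have "4 + l * d * 4 + 4 * (2 * h) = 2 * d * Suc (Suc (2 * l))"
      by (simp add: d_def algebra_simps)
    then show ?thesis
      unfolding s_def Q_def by (simp only: power_mult[symmetric] power_add[symmetric])
  qed
  \<comment> \<open>Both vanishing factors have the form \<open>1 - Q^i\<close>, which is
    \<open>1 - Q\<close> times a geometric sum. Once \<open>1 - Q\<close> is cancelled, the
    geometric sums have the values \<open>2 * l + 1\<close> and \<open>2 * l + 2\<close>.\<close>
  have "1 - Q \<noteq> 0"
    using q1[of "2 * d"] by (simp add: Q_def d_def)
  then have ratio: "(1 - Q ^ i) / (1 - Q ^ j) = (\<Sum>k<i. Q ^ k) / (\<Sum>k<j. Q ^ k)" for i j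
    by (simp add: one_diff_power_eq)
  \<comment> \<open>The first form isolates the numerator factor with index \<open>h\<close>, the
    second the last denominator factor, whose index is \<open>2 * h\<close>.\<close>
  have d: "d = (h + 1) + h" "d = Suc (2 * h)"
    by (simp_all add: d_def)
  have "qpoch (q^2 * s^4) (q^4) d / qpoch (q^4 * s^4) (q^4) d
    = qpoch (q^2 * s^4) (q^4) h * qpoch (q^2 * s^4 * (q^4) ^ (h + 1)) (q^4) h / qpoch (q^4 * s^4) (q^4) (2 * h)
      * ((1 - Q ^ Suc (2 * l)) / (1 - Q ^ Suc (Suc (2 * l))))"
    by (subst (1) d(1), subst d(2)) (simp only: qpoch_add qpoch_Suc top bot add_Suc_right add_0_right One_nat_def, simp)
  also have "\<dots> = qpoch (q^2 * s^4) (q^4) h * qpoch (q^2 * s^4 * (q^4) ^ (h + 1)) (q^4) h / qpoch (q^4 * s^4) (q^4) (2 * h)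
      * ((\<Sum>k<Suc (2 * l). Q ^ k) / (\<Sum>k<Suc (Suc (2 * l)). Q ^ k))"
    unfolding ratio ..
  finally have U: "qpoch (q^2 * s^4) (q^4) d / qpoch (q^4 * s^4) (q^4) d = \<dots>" .
  have "(\<Sum>k<Suc (Suc (2 * l)). (1::'k) ^ k) \<noteq> 0"
    using char_0[of "Suc (2 * l)"] by simp
  then have hU: "has_value \<phi> (qpoch (q^2 * s^4) (q^4) d / qpoch (q^4 * s^4) (q^4) d)
    (qpoch (z^2 * 1^4) (z^4) h * qpoch (z^2 * 1^4 * (z^4) ^ (h + 1)) (z^4) h / qpoch (z^4 * 1^4) (z^4) (2 * h)
      * ((\<Sum>k<Suc (2 * l). 1 ^ k) / (\<Sum>k<Suc (Suc (2 * l)). 1 ^ k)))"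
    unfolding U
    by (intro has_value_mult has_value_divide has_value_qpoch has_value_power has_value_sum place hq s Q)
      (use qpoch_z4_nonzero[of "2 * h"] in \<open>simp_all add: d_def\<close>)
  have hV: "has_value \<phi>
    (qpoch (a * q * s^2) (q^2) d * qpoch (q / a * s^2) (q^2) d * (qpoch (b * q * s^4) (q^4) d * qpoch (q / b * s^4) (q^4) d)
      / (qpoch (q^4 / a * s^4) (q^4) d * qpoch (a * q^4 * s^4) (q^4) d * (qpoch (q^2 / b * s^2) (q^2) d * qpoch (b * q^2 * s^2) (q^2) d)))
    (qpoch (\<alpha> * z * 1^2) (z^2) d * qpoch (z / \<alpha> * 1^2) (z^2) d * (qpoch (\<beta> * z * 1^4) (z^4) d * qpoch (z / \<beta> * 1^4) (z^4) d)
      / (qpoch (z^4 / \<alpha> * 1^4) (z^4) d * qpoch (\<alpha> * z^4 * 1^4) (z^4) d * (qpoch (z^2 / \<beta> * 1^2) (z^2) d * qpoch (\<beta> * z^2 * 1^2) (z^2) d)))"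
    by (intro has_value_mult has_value_divide has_value_qpoch has_value_power place hq ha hb s ab0)
      (use qpoch_z_nonzero in simp_all)
  show ?thesis
    unfolding core_def s_def[symmetric] using has_value_mult[OF place hU hV] by blast
qed

text \<open>The product of the values of the full blocks. It can stay anonymous because it will only
  multiply a block sum equal to 0.\<close>

lemma has_value_core_blocks: "\<exists>w. has_value \<phi> (core q a b 1 (l * d)) w"
proof (induction l)
  case 0
  show ?case
    using has_value_core_block[of 0 0] by (auto simp: d_def)
next
  case (Suc l)
  have "core q a b 1 (Suc l * d) = core q a b 1 (l * d) * core q a b (q ^ (l * d)) d"
    using core_add[of q a b "l * d" d] by (simp add: add.commute)
  then show ?case
    using Suc has_value_core_full_block[of l] has_value_mult[OF place] by metis
qed

text \<open>One \<open>w\<close> serves all \<open>r\<close> of the block: besides the core, the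
  summand contains only the powers of \<open>q\<close> with exponents \<open>6 * k + 1\<close> and
  \<open>2 * k\<close>, and their values depend on \<open>k\<close> modulo \<open>d\<close>
  alone.\<close>

lemma has_value_summand:
  "\<exists>w. \<forall>r<d. has_value \<phi> (summand q a b (l * d + r)) (w * summand z \<alpha> \<beta> r)"
proof -
  obtain w where w: "has_value \<phi> (core q a b 1 (l * d)) w"
    using has_value_core_blocks by blast
  have "has_value \<phi> (summand q a b (l * d + r)) (w * summand z \<alpha> \<beta> r)" if "r < d" for r
  proof -
    have v: "has_value \<phi> (summand q a b (l * d + r))
      ((1 - z ^ (6 * (l * d + r) + 1)) / (1 - z) * (w * core z \<alpha> \<beta> 1 r) * z ^ (2 * (l * d + r)))"
      unfolding summand_core core_add qint_def
      using zi[of 1] h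
      by (intro has_value_mult has_value_divide has_value_power has_value_diff has_value_1 place hq w has_value_core_block that)
        simp
    have "z ^ (6 * (l * d + r) + 1) = (z ^ d) ^ (6 * l) * z ^ (6 * r + 1)"
        "z ^ (2 * (l * d + r)) = (z ^ d) ^ (2 * l) * z ^ (2 * r)"
      by (simp_all only: power_mult[symmetric] power_add[symmetric]) (simp_all add: algebra_simps)
    then have e: "z ^ (6 * (l * d + r) + 1) = z ^ (6 * r + 1)" "z ^ (2 * (l * d + r)) = z ^ (2 * r)"
      using z1 by (simp_all add: d_def)
    show ?thesis
      using v[unfolded e] unfolding summand_core[of z] qint_def by (simp add: mult_ac)
  qed
  then show ?thesis by blast
qed

lemma block_sum: "h < m \<Longrightarrow> (\<Sum>r<m. summand z \<alpha> \<beta> r) = 0"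
proof -
  assume "h < m"
  then have "(\<Sum>r\<le>h. summand z \<alpha> \<beta> r) = (\<Sum>r<m. summand z \<alpha> \<beta> r)"
    by (intro sum.mono_neutral_left) (auto intro: summand_z_eq_0)
  then show ?thesis
    using block_half by simp
qed

lemma has_value_sum_blocks: "has_value \<phi> (\<Sum>k<L * d. summand q a b k) 0"
proof (induction L)
  case 0
  show ?case by (simp add: has_value_0[OF place])
next
  case (Suc l)
  obtain w where w: "\<And>r. r < d \<Longrightarrow> has_value \<phi> (summand q a b (l * d + r)) (w * summand z \<alpha> \<beta> r)"
    using has_value_summand by blast
  have "(\<Sum>k<Suc l * d. summand q a b k) = (\<Sum>k<l * d. summand q a b k) + (\<Sum>r<d. summand q a b (l * d + r))"
    using sum_lessThan_add[of "summand q a b" "l * d" d] by (simp add: add.commute)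
  moreover have "has_value \<phi> (\<Sum>r<d. summand q a b (l * d + r)) (\<Sum>r<d. w * summand z \<alpha> \<beta> r)"
    by (rule has_value_sum[OF place]) (simp add: w)
  then have "has_value \<phi> (\<Sum>r<d. summand q a b (l * d + r)) 0"
    using block_sum[of d] by (simp add: d_def flip: sum_distrib_left)
  ultimately show ?case
    using has_value_add[OF place Suc.IH] by fastforce
qed

text \<open>For \<open>n = e * d\<close> the limit \<open>n - 1\<close> closes \<open>e\<close> full
  blocks, while \<open>(n - 1) / 2\<close> stops at index \<open>h\<close> of a block, exactly where
  its nonzero values stop.\<close>

lemma has_value_sum_zero:
  assumes "M + 1 = L * d \<or> M = L * d + h"
  shows "has_value \<phi> (\<Sum>k=0..M. summand q a b k) 0"
  using assms
proof
  assume "M + 1 = L * d"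
  then have "{0..M} = {..<L * d}" by auto
  then show ?thesis
    using has_value_sum_blocks[of L] by simp
next
  assume M: "M = L * d + h"
  obtain w where w: "\<And>r. r < d \<Longrightarrow> has_value \<phi> (summand q a b (L * d + r)) (w * summand z \<alpha> \<beta> r)"
    using has_value_summand by blast
  have "{0..M} = {..<L * d + Suc h}" using M by auto
  then have "(\<Sum>k=0..M. summand q a b k) = (\<Sum>k<L * d. summand q a b k) + (\<Sum>r<Suc h. summand q a b (L * d + r))"
    by (simp only: sum_lessThan_add)
  moreover have "has_value \<phi> (\<Sum>r<Suc h. summand q a b (L * d + r)) (\<Sum>r<Suc h. w * summand z \<alpha> \<beta> r)"
    using h by (intro has_value_sum[OF place] w) (auto simp: d_def)
  then have "has_value \<phi> (\<Sum>r<Suc h. summand q a b (L * d + r)) 0"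
    using block_sum[of "Suc h"] by (simp only: sum_distrib_left[symmetric]) simp
  ultimately show ?thesis
    using has_value_add[OF place has_value_sum_blocks[of L]] by fastforce
qed

end

subsection \<open>Kernels of places\<close>

lemma place_comp:
  assumes "place \<phi>" "place \<psi>"
  shows "place (\<lambda>x. \<psi> (\<phi> x))"
  using assms by (simp add: place_def)

lemma place_const: "place (\<lambda>c::'a::idom. to_fract [:c:])"
proof -
  have "to_fract [:x * y:] = to_fract [:x:] * to_fract [:y:]"
    "to_fract [:x + y:] = to_fract [:x:] + to_fract [:y:]" for x y :: 'a
    by (simp_all flip: to_fract_mult to_fract_add)
  moreover have "to_fract [:1::'a:] = 1"
    by (simp add: pCons_one)
  ultimately show ?thesis
    unfolding place_def by blast
qed

lemma place_field_inj:
  fixes \<phi> :: "'a::field \<Rightarrow> 'k::field"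
  assumes "place \<phi>"
  shows "\<phi> x = \<phi> y \<longleftrightarrow> x = y"
proof -
  have "x = y" if eq: "\<phi> x = \<phi> y"
  proof (rule ccontr)
    assume "x \<noteq> y"
    then have "\<phi> ((x - y) * (1 / (x - y))) = 1"
      using place_1[OF assms] by simp
    then have "(\<phi> x - \<phi> y) * \<phi> (1 / (x - y)) = 1"
      by (simp only: place_mult[OF assms] place_diff[OF assms])
    then show False
      by (simp add: eq)
  qed
  then show ?thesis
    by blast
qed

lemma place_of_nat: "place \<phi> \<Longrightarrow> \<phi> (of_nat n) = of_nat n"
  by (induction n) (simp_all add: place_0 place_1 place_add)

text \<open>Gauss's lemma: the linear polynomial is primitive, so divisibility over the fraction
  field descends to the ring. The root \<open>- u / v\<close> covers both \<open>1 - c * X\<close>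
  and \<open>X - c\<close>.\<close>

lemma kernel_eval:
  fixes u v :: "'a::{idom_divide,ring_gcd,factorial_semiring,semiring_Gcd,semiring_gcd_mult_normalize}"
  assumes "coprime u v" "v \<noteq> 0"
  shows "poly (fract_poly N) (- (to_fract u / to_fract v)) = 0 \<longleftrightarrow> [:u, v:] dvd N"
proof -
  define r where "r = - (to_fract u / to_fract v)"
  have eq: "fract_poly [:u, v:] = smult (to_fract v) [:- r, 1:]"
    using assms by (simp add: map_poly_pCons r_def)
  have "poly (fract_poly N) r = 0 \<longleftrightarrow> fract_poly [:u, v:] dvd fract_poly N"
    unfolding eq poly_eq_0_iff_dvd using assms(2) by (subst smult_dvd_iff) simp
  also have "\<dots> \<longleftrightarrow> [:u, v:] dvd N"
  proof
    assume "fract_poly [:u, v:] dvd fract_poly N"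
    moreover have "content [:u, v:] = 1"
      using assms by (simp add: content_def)
    ultimately show "[:u, v:] dvd N"
      by (rule fract_poly_dvdD)
  next
    assume "[:u, v:] dvd N"
    then obtain k where "N = [:u, v:] * k" ..
    then have "fract_poly N = fract_poly [:u, v:] * fract_poly k"
      by (simp only: fract_poly_mult)
    then show "fract_poly [:u, v:] dvd fract_poly N" ..
  qed
  finally show ?thesis
    unfolding r_def .
qed

lemma kernel_map_poly:
  assumes "place \<phi>" "\<And>x. \<phi> x = 0 \<longleftrightarrow> p dvd x"
  shows "to_fract (map_poly \<phi> N) = 0 \<longleftrightarrow> [:p:] dvd N"
  by (simp add: const_poly_dvd_iff poly_eq_iff coeff_map_poly place_0[OF assms(1)] assms(2))

lemma prime_elem_const_linear_poly:
  fixes u v :: "'a::{idom_divide,ring_gcd,factorial_semiring,semiring_Gcd,semiring_gcd_mult_normalize}"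
  assumes "coprime u v" "v \<noteq> 0"
  shows "prime_elem [:[:u, v:]:]"
  using prime_elem_linear_poly[of v u] assms by (simp add: prime_elem_const_poly_iff)

section \<open>The q-integer as a polynomial and its complex roots\<close>

definition qint_poly :: "nat \<Rightarrow> 'a::comm_ring_1 poly" where
  "qint_poly n = (\<Sum>i<n. [:0, 1:] ^ i)"

lemma qint_poly_mult: "[:- 1, 1:] * qint_poly n = [:0, 1:] ^ n - (1 :: 'a::comm_ring_1 poly)"
proof -
  have "[:- 1, 1:] = [:0, 1:] - (1 :: 'a poly)"
    by (simp add: one_pCons)
  then show ?thesis
    unfolding qint_poly_def by (simp only: power_diff_1_eq)
qed

lemma root_qint_poly:
  fixes \<zeta> :: complex
  assumes "n > 0"
  shows "poly (map_poly of_rat (qint_poly n)) \<zeta> = 0 \<longleftrightarrow> \<zeta> ^ n = 1 \<and> \<zeta> \<noteq> 1"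
proof -
  note pl = place_eval[OF place_of_rat, of \<zeta>]
  have X: "poly (map_poly of_rat ([:0, 1:] ^ i)) \<zeta> = \<zeta> ^ i" for i
    using place_power[OF pl, of "[:0, 1:]" i] by (simp add: map_poly_pCons)
  have val: "poly (map_poly of_rat (qint_poly n)) \<zeta> = (\<Sum>i<n. \<zeta> ^ i)"
    unfolding qint_poly_def by (simp only: place_sum[OF pl] X)
  show ?thesis
  proof (cases "\<zeta> = 1")
    case True
    then show ?thesis using val assms by simp
  next
    case False
    then show ?thesis
      using power_diff_1_eq[of \<zeta> n] unfolding val by auto
  qed
qed

text \<open>The polynomial \<open>X^n - 1\<close> has \<open>n\<close> distinct complex roots. The
  remainder of \<open>(X - 1) * c\<close> modulo it vanishes at all of them, the factor
  \<open>X - 1\<close> supplying the root 1, but has degree below \<open>n\<close>, so it is 0.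
  Counting roots replaces a factorisation into cyclotomic polynomials.\<close>

lemma qint_poly_dvd:
  fixes c :: "rat poly"
  assumes "n > 0" and roots: "\<And>\<zeta>::complex. \<zeta> ^ n = 1 \<Longrightarrow> \<zeta> \<noteq> 1 \<Longrightarrow> poly (map_poly of_rat c) \<zeta> = 0"
  shows "qint_poly n dvd c"
proof -
  define p where "p = ([:0, 1:] ^ n - 1 :: rat poly)"
  define r where "r = ([:- 1, 1:] * c) mod p"
  have "[:0, 1:] ^ n = (monom 1 n :: rat poly)"
    by (simp add: monom_altdef)
  then have deg: "degree p = n"
    unfolding p_def diff_conv_add_uminus using assms(1)
    by (subst degree_add_eq_left) (simp_all add: degree_monom_eq)
  then have "p \<noteq> 0"
    using assms(1) by auto
  have "poly (map_poly of_rat r) \<zeta> = 0" if "\<zeta> ^ n = 1" for \<zeta> :: complex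
  proof -
    note pl = place_eval[OF place_of_rat, of \<zeta>]
    have X: "poly (map_poly of_rat [:0, 1:]) \<zeta> = \<zeta>" "poly (map_poly of_rat [:- 1, 1:]) \<zeta> = \<zeta> - 1"
      by (simp_all add: map_poly_pCons)
    have "poly (map_poly of_rat p) \<zeta> = 0"
      unfolding p_def place_diff[OF pl] place_power[OF pl] place_1[OF pl] X using that by simp
    moreover have "poly (map_poly of_rat ([:- 1, 1:] * c)) \<zeta> = 0"
      unfolding place_mult[OF pl] X using roots[of \<zeta>] that by (cases "\<zeta> = 1") auto
    moreover have "r = [:- 1, 1:] * c - ([:- 1, 1:] * c) div p * p"
      unfolding r_def by (rule minus_div_mult_eq_mod[symmetric])
    ultimately show ?thesis
      by (simp only: place_diff[OF pl] place_mult[OF pl]) simp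
  qed
  then have sub: "{\<zeta>::complex. \<zeta> ^ n = 1} \<subseteq> {\<zeta>. poly (map_poly of_rat r) \<zeta> = 0}"
    by auto
  have "r = 0"
  proof (rule ccontr)
    assume "r \<noteq> 0"
    then have deg_r: "degree r < n"
      using degree_mod_less[OF \<open>p \<noteq> 0\<close>, of "[:- 1, 1:] * c"] deg by (simp add: r_def)
    have r': "map_poly of_rat r \<noteq> (0 :: complex poly)"
      using \<open>r \<noteq> 0\<close> by (simp add: map_poly_eq_0_iff)
    have "n = card {\<zeta>::complex. \<zeta> ^ n = 1}"
      using assms(1) by (simp add: card_roots_unity_eq)
    also have "\<dots> \<le> card {\<zeta>. poly (map_poly of_rat r) \<zeta> = (0::complex)}"
      by (intro card_mono sub poly_roots_finite r')
    also have "\<dots> \<le> degree (map_poly of_rat r :: complex poly)"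
      by (rule card_poly_roots_bound[OF r'])
    also have "\<dots> = degree r"
      by (rule degree_map_poly) simp
    finally show False using deg_r by simp
  qed
  then have "p dvd [:- 1, 1:] * c"
    by (simp only: r_def dvd_eq_mod_eq_0)
  then have "[:- 1, 1:] * qint_poly n dvd [:- 1, 1:] * c"
    by (simp only: p_def qint_poly_mult)
  then show ?thesis
    by (subst (asm) dvd_mult_cancel_left) auto
qed

text \<open>
  The substitutions \<open>b = r\<close>, \<open>a = r\<close> and \<open>q = \<zeta>\<close>, with the remaining indeterminates kept.
\<close>

definition place_b :: "rat poly poly fract \<Rightarrow> poly_qab \<Rightarrow> rat poly poly fract" where
  "place_b r N = poly (fract_poly N) r"

definition place_a :: "rat poly fract \<Rightarrow> poly_qab \<Rightarrow> rat poly fract poly fract" where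
  "place_a r N = to_fract (map_poly (\<lambda>c. poly (fract_poly c) r) N)"

definition place_zeta :: "complex \<Rightarrow> poly_qab \<Rightarrow> complex poly fract poly fract" where
  "place_zeta \<zeta> N = to_fract (map_poly (\<lambda>p. to_fract (map_poly (\<lambda>c. poly (map_poly of_rat c) \<zeta>) p)) N)"

lemma place_place_b: "place (place_b r)"
  unfolding place_b_def by (intro place_eval place_to_fract)

lemma place_place_a: "place (place_a r)"
  unfolding place_a_def by (intro place_map_poly place_eval place_to_fract)

lemma place_place_zeta: "place (place_zeta \<zeta>)"
  unfolding place_zeta_def by (intro place_map_poly place_eval place_of_rat)

lemma const_poly_dvd_constD: "[:x:] dvd [:y:] \<Longrightarrow> x dvd y"
  for x y :: "'a::idom"
  using const_poly_dvd_iff[of x "[:y:]"] coeff_pCons_0[of y 0] by metis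

text \<open>A common divisor has degree 0 in \<open>b\<close> and \<open>a\<close> because it
  divides a polynomial in \<open>q\<close> alone. If it had positive degree in \<open>q\<close>, a
  complex root of it would be a nontrivial root of unity at which \<open>D\<close> vanishes.\<close>

lemma coprime_qint_poly:
  fixes D :: poly_qab
  assumes "n > 0" and D: "\<And>\<zeta>. \<zeta> ^ n = 1 \<Longrightarrow> \<zeta> \<noteq> 1 \<Longrightarrow> place_zeta \<zeta> D \<noteq> 0"
  shows "coprime D [:[:qint_poly n:]:]"
proof (rule coprimeI)
  fix c :: poly_qab
  assume "c dvd D" "c dvd [:[:qint_poly n:]:]"
  have "poly (qint_poly n) 1 = (of_nat n :: rat)"
    by (simp add: qint_poly_def poly_sum poly_power)
  then have nz: "qint_poly n \<noteq> (0 :: rat poly)"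
    using assms(1) by auto
  obtain c1 where c1: "c = [:c1:]"
    using \<open>c dvd [:[:qint_poly n:]:]\<close> nz dvd_imp_degree_le[of c "[:[:qint_poly n:]:]"]
    by (auto elim: degree_eq_zeroE)
  then have c1_dvd: "c1 dvd [:qint_poly n:]"
    using \<open>c dvd [:[:qint_poly n:]:]\<close> by (simp add: const_poly_dvd_constD)
  then obtain c0 where c0: "c1 = [:c0:]"
    using nz dvd_imp_degree_le[of c1 "[:qint_poly n:]"] by (auto elim: degree_eq_zeroE)
  then have c0_dvd: "c0 dvd qint_poly n"
    using c1_dvd by (simp add: const_poly_dvd_constD)
  have "degree c0 = 0"
  proof (rule ccontr)
    assume "degree c0 \<noteq> 0"
    then have "degree (map_poly of_rat c0 :: complex poly) \<noteq> 0"
      by (subst degree_map_poly) auto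
    then have "\<not> constant (poly (map_poly of_rat c0 :: complex poly))"
      by (simp add: constant_degree)
    then obtain \<zeta> :: complex where \<zeta>: "poly (map_poly of_rat c0) \<zeta> = 0"
      using fundamental_theorem_of_algebra by blast
    note pl = place_eval[OF place_of_rat, of \<zeta>]
    obtain k where "qint_poly n = c0 * k"
      using c0_dvd ..
    then have "poly (map_poly of_rat (qint_poly n)) \<zeta> = 0"
      by (simp only: place_mult[OF pl] \<zeta> mult_zero_left)
    then have "\<zeta> ^ n = 1" "\<zeta> \<noteq> 1"
      using root_qint_poly[OF assms(1)] by blast+
    moreover have "place_zeta \<zeta> c = 0"
      using \<zeta> by (simp add: c1 c0 place_zeta_def map_poly_pCons)
    then have "place_zeta \<zeta> D = 0"
      using \<open>c dvd D\<close> by (auto simp: place_mult[OF place_place_zeta])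
    ultimately show False
      using D by blast
  qed
  then obtain e where "c0 = [:e:]"
    by (auto elim: degree_eq_zeroE)
  moreover have "c0 \<noteq> 0"
    using c0_dvd nz by auto
  ultimately show "is_unit c"
    by (simp add: c1 c0 is_unit_const_poly_iff dvd_field_iff)
qed

lemma qint_poly_const_dvd:
  fixes N :: poly_qab
  assumes "n > 0" and N: "\<And>\<zeta>. \<zeta> ^ n = 1 \<Longrightarrow> \<zeta> \<noteq> 1 \<Longrightarrow> place_zeta \<zeta> N = 0"
  shows "[:[:qint_poly n:]:] dvd N"
  unfolding const_poly_dvd_iff
proof (intro allI qint_poly_dvd[OF assms(1)])
  fix i j and \<zeta> :: complex
  assume "\<zeta> ^ n = 1" "\<zeta> \<noteq> 1"
  then have "place_zeta \<zeta> N = 0" by (rule N)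
  then have "coeff (map_poly (\<lambda>p. to_fract (map_poly (\<lambda>c. poly (map_poly of_rat c) \<zeta>) p)) N) i = 0"
    by (simp add: place_zeta_def)
  then have "map_poly (\<lambda>c. poly (map_poly of_rat c) \<zeta>) (coeff N i) = 0"
    by (simp add: coeff_map_poly)
  then have "coeff (map_poly (\<lambda>c. poly (map_poly of_rat c) \<zeta>) (coeff N i)) j = 0"
    by simp
  then show "poly (map_poly of_rat (coeff (coeff N i) j)) \<zeta> = 0"
    by (simp add: coeff_map_poly)
qed

section \<open>From values at places to the congruence\<close>

lemma has_value_quot_of_fract:
  fixes f :: ratfun_qab
  assumes "place \<phi>" "has_value \<phi> f v"
  shows "\<phi> (snd (quot_of_fract f)) \<noteq> 0" "v = \<phi> (fst (quot_of_fract f)) / \<phi> (snd (quot_of_fract f))"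
proof -
  have "f = to_fract (fst (quot_of_fract f)) / to_fract (snd (quot_of_fract f))"
    by (simp flip: Fract_conv_to_fract add: Fract_quot_of_fract)
  moreover have "snd (quot_of_fract f) dvd x" if "snd (quot_of_fract f) dvd fst (quot_of_fract f) * x" for x
    using that coprime_quot_of_fract[of f] by (simp add: coprime_dvd_mult_right_iff coprime_commute)
  ultimately show "\<phi> (snd (quot_of_fract f)) \<noteq> 0" "v = \<phi> (fst (quot_of_fract f)) / \<phi> (snd (quot_of_fract f))"
    using has_value_coprime[OF assms(1,2)] snd_quot_of_fract_nonzero[of f] by blast+
qed

text \<open>Handles the four linear factors of the modulus. The q-integer is not prime in general
  and has its own criterion in \<open>coprime_qint_poly\<close>.\<close>

lemma coprime_prime_elem:
  fixes \<pi> :: poly_qab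
  assumes "prime_elem \<pi>" "\<And>N. \<phi> N = 0 \<longleftrightarrow> \<pi> dvd N" "\<phi> D \<noteq> 0"
  shows "coprime D \<pi>"
  using prime_elem_imp_coprime[of \<pi> D] assms by (simp add: coprime_commute)

lemma const_poly_power: "[:c:] ^ n = [:c ^ n:]" for c :: "'a::comm_semiring_1"
  by (induction n) (simp_all add: pCons_one mult.commute)

lemma x_power_neq_1: "j > 0 \<Longrightarrow> [:0, 1:] ^ j \<noteq> (1 :: 'a::idom poly)"
proof
  assume "j > 0" "[:0, 1:] ^ j = (1 :: 'a poly)"
  then have "poly ([:0, 1:] ^ j) 0 = poly (1 :: 'a poly) 0" by simp
  then show False using \<open>j > 0\<close> by (simp add: poly_power zero_power)
qed

text \<open>Everything is read off from lowest terms. Having a value keeps the reduced denominator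
  coprime to the factor of the modulus belonging to the place; a common value of \<open>f\<close>
  and \<open>g\<close> puts the reduced numerator of \<open>f - g\<close> into the kernel, hence
  makes it divisible by that factor.\<close>

lemma ratfun_cong_qint:
  fixes f g :: ratfun_qab and n :: nat
  defines "c \<equiv> to_fract [:[:0, 1:] ^ n:]" and "c' \<equiv> to_fract ([:0, 1:] ^ n)"
  assumes n: "n > 0"
    and zeta: "\<And>\<zeta>. \<zeta> ^ n = 1 \<Longrightarrow> \<zeta> \<noteq> 1 \<Longrightarrow> has_value (place_zeta \<zeta>) f 0 \<and> has_value (place_zeta \<zeta>) g 0"
    and a: "\<And>r. r = c' \<or> r = 1 / c' \<Longrightarrow> \<exists>v. has_value (place_a r) f v \<and> has_value (place_a r) g v"
    and b: "\<And>r. r = c \<or> r = 1 / c \<Longrightarrow> \<exists>v. has_value (place_b r) f v \<and> has_value (place_b r) g v"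
  shows "ratfun_cong (qint indet_q n * (1 - indet_a * indet_q ^ n) * (indet_a - indet_q ^ n)
      * (1 - indet_b * indet_q ^ n) * (indet_b - indet_q ^ n)) f g"
proof -
  define X where "X = ([:0, 1:] ^ n :: rat poly)"
  define p0 p1 p2 p3 p4 :: poly_qab
    where p_defs: "p0 = [:[:qint_poly n:]:]" "p1 = [:[:1, - X:]:]" "p2 = [:[:- X, 1:]:]" "p3 = [:1, - [:X:]:]" "p4 = [:- [:X:], 1:]"
  define P where "P = p0 * p1 * p2 * p3 * p4"
  have X0: "X \<noteq> 0" by (simp add: X_def)
  have XX: "X * X \<noteq> 1"
    using x_power_neq_1[of "n + n", where 'a = rat] n by (simp add: X_def power_add)
  have qn: "indet_q ^ n = to_fract [:[:X:]:]"
    unfolding indet_q_def X_def by (simp only: place_power[OF place_to_fract, symmetric] const_poly_power)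
  have "qint indet_q n = to_fract p0"
  proof -
    have "p0 * (1 - [:[:[:0, 1:]:]:]) = 1 - [:[:X:]:]"
    proof -
      have "qint_poly n * (1 - [:0, 1:]) = (1 - X :: rat poly)"
      proof -
        have "1 - [:0, 1:] = - [:- 1, 1 :: rat:]"
          by (simp add: one_pCons)
        then have "qint_poly n * (1 - [:0, 1:]) = - ([:- 1, 1:] * (qint_poly n :: rat poly))"
          by (simp only: mult_minus_right mult.commute)
        then show ?thesis
          by (simp only: qint_poly_mult X_def minus_diff_eq)
      qed
      then have "[:[:qint_poly n * (1 - [:0, 1:]):]:] = [:[:1 - X:]:]"
        by simp
      then show ?thesis
        by (simp add: p_defs one_pCons)
    qed
    then have "to_fract p0 * (1 - indet_q) = 1 - indet_q ^ n"
      unfolding qn unfolding indet_q_def by (simp only: to_fract_1[symmetric] to_fract_diff[symmetric] to_fract_mult[symmetric])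
    moreover have "1 - indet_q \<noteq> 0"
      unfolding indet_q_def by (simp only: to_fract_1[symmetric] to_fract_diff[symmetric] to_fract_eq_0_iff) (simp add: one_pCons)
    ultimately show ?thesis
      by (simp add: qint_def nonzero_divide_eq_eq)
  qed
  moreover have "1 - indet_a * indet_q ^ n = to_fract p1" "indet_a - indet_q ^ n = to_fract p2"
    "1 - indet_b * indet_q ^ n = to_fract p3" "indet_b - indet_q ^ n = to_fract p4"
    unfolding qn unfolding indet_a_def indet_b_def
    by (simp_all only: to_fract_1[symmetric] to_fract_diff[symmetric] to_fract_mult[symmetric])
      (simp_all add: p_defs one_pCons)
  ultimately have modulus: "qint indet_q n * (1 - indet_a * indet_q ^ n) * (indet_a - indet_q ^ n)
      * (1 - indet_b * indet_q ^ n) * (indet_b - indet_q ^ n) = to_fract P"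
    by (simp only: P_def to_fract_mult)
  have minus: "to_fract [:- X:] = - to_fract [:X:]"
    by (simp flip: to_fract_uminus)
  \<comment> \<open>With \<open>c\<close> standing for \<open>q^n\<close>, the point
    \<open>1 / c\<close> is the zero of \<open>1 - b * q^n\<close> and \<open>c\<close> that of
    \<open>b - q^n\<close>.\<close>
  have ker_b: "place_b (1 / c) N = 0 \<longleftrightarrow> p3 dvd N" "place_b c N = 0 \<longleftrightarrow> p4 dvd N" for N
    using kernel_eval[of 1 "- [:X:]" N] kernel_eval[of "- [:X:]" 1 N] X0
    by (simp_all add: place_b_def p_defs c_def X_def[symmetric] minus)
  \<comment> \<open>The indeterminate \<open>a\<close> sits inside the coefficients of polynomials
    in \<open>b\<close>, so its kernel is determined first for a single coefficient.\<close>
  have inner: "poly (fract_poly x) (1 / c') = 0 \<longleftrightarrow> [:1, - X:] dvd x" "poly (fract_poly x) c' = 0 \<longleftrightarrow> [:- X, 1:] dvd x" for x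
    using kernel_eval[of 1 "- X" x] kernel_eval[of "- X" 1 x] X0
    by (simp_all add: c'_def X_def[symmetric])
  have ker_a: "place_a (1 / c') N = 0 \<longleftrightarrow> p1 dvd N" "place_a c' N = 0 \<longleftrightarrow> p2 dvd N" for N
    unfolding place_a_def p_defs by (rule kernel_map_poly[OF place_eval[OF place_to_fract]], rule inner)+
  have prime: "prime_elem p1" "prime_elem p2" "prime_elem p3" "prime_elem p4"
    unfolding p_defs using X0 by (auto intro!: prime_elem_const_linear_poly prime_elem_linear_poly)
  have cop: "coprime D P"
    if "\<And>\<zeta>. \<zeta> ^ n = 1 \<Longrightarrow> \<zeta> \<noteq> 1 \<Longrightarrow> place_zeta \<zeta> D \<noteq> 0"
      "place_a (1 / c') D \<noteq> 0" "place_a c' D \<noteq> 0" "place_b (1 / c) D \<noteq> 0" "place_b c D \<noteq> 0" for D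
    unfolding P_def coprime_mult_right_iff
    using coprime_qint_poly[OF n, of D] coprime_prime_elem[OF prime(1) ker_a(1)] coprime_prime_elem[OF prime(2) ker_a(2)]
      coprime_prime_elem[OF prime(3) ker_b(1)] coprime_prime_elem[OF prime(4) ker_b(2)] that
    by (simp add: p_defs(1))
  have div: "P dvd N"
    if "\<And>\<zeta>. \<zeta> ^ n = 1 \<Longrightarrow> \<zeta> \<noteq> 1 \<Longrightarrow> place_zeta \<zeta> N = 0"
      "place_a (1 / c') N = 0" "place_a c' N = 0" "place_b (1 / c) N = 0" "place_b c N = 0" for N
  proof -
    \<comment> \<open>Pairwise coprimality is tested with the same places: one factor must not
      vanish at the places of the other. For the two factors in the same indeterminate this amounts
      to \<open>q^(2 * n) \<noteq> 1\<close>.\<close>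
    have "coprime p1 p0" "coprime p2 p0" "coprime p3 p0" "coprime p4 p0"
      unfolding p_defs by (rule coprime_qint_poly[OF n], simp add: place_zeta_def map_poly_pCons)+
    moreover have "coprime p2 p1"
    proof (rule coprime_prime_elem[OF prime(1) ker_a(1)])
      have "c' * c' \<noteq> 1"
        using XX by (simp add: c'_def X_def[symmetric] flip: to_fract_mult to_fract_1)
      then show "place_a (1 / c') p2 \<noteq> 0"
        using X0 by (simp add: place_a_def p_defs map_poly_pCons c'_def X_def[symmetric] field_simps)
    qed
    moreover have "coprime p4 p3"
    proof (rule coprime_prime_elem[OF prime(3) ker_b(1)])
      have "[:X:] * [:X:] \<noteq> 1"
        using XX by (simp add: one_pCons)
      then have "c * c \<noteq> 1"
        by (simp add: c_def X_def[symmetric] flip: to_fract_mult to_fract_1)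
      then show "place_b (1 / c) p4 \<noteq> 0"
        using X0 by (simp add: place_b_def p_defs map_poly_pCons c_def X_def[symmetric] field_simps minus)
    qed
    moreover have "coprime p3 p1" "coprime p4 p1" "coprime p3 p2" "coprime p4 p2"
      by (rule coprime_prime_elem[OF prime(1) ker_a(1)] coprime_prime_elem[OF prime(2) ker_a(2)],
          simp add: place_a_def p_defs map_poly_pCons)+
    ultimately have "coprime p0 p1" "coprime (p0 * p1) p2" "coprime (p0 * p1 * p2) p3" "coprime (p0 * p1 * p2 * p3) p4"
      by (simp_all add: coprime_commute)
    moreover have "p0 dvd N" "p1 dvd N" "p2 dvd N" "p3 dvd N" "p4 dvd N"
      using that qint_poly_const_dvd[OF n, of N] ker_a ker_b by (simp_all add: p_defs(1))
    ultimately show ?thesis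
      unfolding P_def by (intro divides_mult)
  qed
  have cop_quot: "coprime (snd (quot_of_fract x)) P"
    if x_zeta: "\<And>\<zeta>. \<zeta> ^ n = 1 \<Longrightarrow> \<zeta> \<noteq> 1 \<Longrightarrow> has_value (place_zeta \<zeta>) x 0"
      and x_a: "\<And>r. r = c' \<or> r = 1 / c' \<Longrightarrow> \<exists>v. has_value (place_a r) x v"
      and x_b: "\<And>r. r = c \<or> r = 1 / c \<Longrightarrow> \<exists>v. has_value (place_b r) x v" for x
  proof (rule cop)
    show "place_zeta \<zeta> (snd (quot_of_fract x)) \<noteq> 0" if "\<zeta> ^ n = 1" "\<zeta> \<noteq> 1" for \<zeta>
      by (rule has_value_quot_of_fract(1)[OF place_place_zeta x_zeta[OF that]])
    show "place_a (1 / c') (snd (quot_of_fract x)) \<noteq> 0" "place_a c' (snd (quot_of_fract x)) \<noteq> 0"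
      using x_a[of "1 / c'"] x_a[of c'] has_value_quot_of_fract(1)[OF place_place_a] by simp_all blast+
    show "place_b (1 / c) (snd (quot_of_fract x)) \<noteq> 0" "place_b c (snd (quot_of_fract x)) \<noteq> 0"
      using x_b[of "1 / c"] x_b[of c] has_value_quot_of_fract(1)[OF place_place_b] by simp_all blast+
  qed
  have quot: "x = Fraction_Field.Fract (fst (quot_of_fract x)) (snd (quot_of_fract x))" for x :: ratfun_qab
    by (rule Fract_quot_of_fract[symmetric])
  have denom: "denom_coprime P x" if "coprime (snd (quot_of_fract x)) P" for x
    unfolding denom_coprime_def
    by (rule exI[of _ "fst (quot_of_fract x)"], rule exI[of _ "snd (quot_of_fract x)"])
      (intro conjI snd_quot_of_fract_nonzero that quot)
  have f: "denom_coprime P f"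
    by (rule denom, rule cop_quot) (use zeta a b in blast)+
  have g: "denom_coprime P g"
    by (rule denom, rule cop_quot) (use zeta a b in blast)+
  have zeta': "has_value (place_zeta \<zeta>) (f - g) 0" if "\<zeta> ^ n = 1" "\<zeta> \<noteq> 1" for \<zeta>
    using zeta[OF that] has_value_diff[OF place_place_zeta, of \<zeta> f 0 g 0] by simp
  have a': "has_value (place_a r) (f - g) 0" if "r = c' \<or> r = 1 / c'" for r
  proof -
    obtain v where "has_value (place_a r) f v" "has_value (place_a r) g v"
      using a[OF \<open>r = c' \<or> r = 1 / c'\<close>] by blast
    then show ?thesis
      using has_value_diff[OF place_place_a, of r f v g v] by simp
  qed
  have b': "has_value (place_b r) (f - g) 0" if "r = c \<or> r = 1 / c" for r
  proof -
    obtain v where "has_value (place_b r) f v" "has_value (place_b r) g v"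
      using b[OF \<open>r = c \<or> r = 1 / c\<close>] by blast
    then show ?thesis
      using has_value_diff[OF place_place_b, of r f v g v] by simp
  qed
  have "coprime (snd (quot_of_fract (f - g))) P"
    by (rule cop_quot) (blast intro: zeta' a' b')+
  moreover have "P dvd fst (quot_of_fract (f - g))"
  proof (rule div)
    show "place_zeta \<zeta> (fst (quot_of_fract (f - g))) = 0" if "\<zeta> ^ n = 1" "\<zeta> \<noteq> 1" for \<zeta>
      using has_value_quot_of_fract[OF place_place_zeta zeta'[OF that]] by simp
    show "place_a (1 / c') (fst (quot_of_fract (f - g))) = 0" "place_a c' (fst (quot_of_fract (f - g))) = 0"
      using has_value_quot_of_fract[OF place_place_a a'[of "1 / c'"]] has_value_quot_of_fract[OF place_place_a a'[of c']]
      by simp_all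
    show "place_b (1 / c) (fst (quot_of_fract (f - g))) = 0" "place_b c (fst (quot_of_fract (f - g))) = 0"
      using has_value_quot_of_fract[OF place_place_b b'[of "1 / c"]] has_value_quot_of_fract[OF place_place_b b'[of c]]
      by simp_all
  qed
  ultimately show ?thesis
    unfolding ratfun_cong_def modulus
    by (intro exI[of _ P] conjI refl f g exI[of _ "fst (quot_of_fract (f - g))"] exI[of _ "snd (quot_of_fract (f - g))"]
        snd_quot_of_fract_nonzero quot)
qed

subsection \<open>The congruence\<close>

definition rhs :: "'a::field \<Rightarrow> 'a \<Rightarrow> 'a \<Rightarrow> nat \<Rightarrow> 'a" where
  "rhs q a b n =
    (1 - a * q ^ n) * (a - q ^ n) * (- 1 - b\<^sup>2 + b * q ^ n) / ((b - a) * (1 - b * a)) * closed_form q a ((n - 1) div 4)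
    + (1 - b * q ^ n) * (b - q ^ n) * (- 1 - a\<^sup>2 + a * q ^ n) / ((a - b) * (1 - a * b)) * closed_form q b ((n - 1) div 4)"

text \<open>Only even exponents are excluded, because the denominators of the summand involve
  \<open>a\<close> and \<open>b\<close> only through even powers of \<open>q\<close> times the
  parameter or its inverse. Hence the parameter may be \<open>q^n\<close> or its inverse with odd
  \<open>n\<close>.\<close>

definition admissible :: "'a::field \<Rightarrow> 'a \<Rightarrow> bool" where
  "admissible q a \<longleftrightarrow> a \<noteq> 0 \<and> (\<forall>j>0. a * q ^ (2 * j) \<noteq> 1 \<and> q ^ (2 * j) \<noteq> a)"

lemma admissible_qpoch_nonzero:
  assumes "admissible q a"
  shows "qpoch (q^2 / a) (q^2) k \<noteq> 0" "qpoch (a * q^2) (q^2) k \<noteq> 0"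
    "qpoch (q^4 / a) (q^4) k \<noteq> 0" "qpoch (a * q^4) (q^4) k \<noteq> 0"
proof -
  have a: "a \<noteq> 0" "\<And>j. j > 0 \<Longrightarrow> a * q ^ (2 * j) \<noteq> 1" "\<And>j. j > 0 \<Longrightarrow> q ^ (2 * j) \<noteq> a"
    using assms by (auto simp: admissible_def)
  have "2 * (2 * Suc j) = 4 * Suc j" for j by simp
  then have e: "q^2 * (q^2) ^ j = q ^ (2 * Suc j)" "q^4 * (q^4) ^ j = q ^ (2 * (2 * Suc j))" for j
    by (simp_all only: power_mult power_Suc)
  have e': "c * q^4 * (q^4) ^ j = c * q ^ (2 * (2 * Suc j))" "c * q^2 * (q^2) ^ j = c * q ^ (2 * Suc j)"
      "q^4 / c * (q^4) ^ j = q ^ (2 * (2 * Suc j)) / c" "q^2 / c * (q^2) ^ j = q ^ (2 * Suc j) / c" for c j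
    unfolding e[symmetric] by simp_all
  have pos: "0 < 2 * Suc j" "0 < Suc j" for j by simp_all
  show "qpoch (q^2 / a) (q^2) k \<noteq> 0" "qpoch (a * q^2) (q^2) k \<noteq> 0"
    "qpoch (q^4 / a) (q^4) k \<noteq> 0" "qpoch (a * q^4) (q^4) k \<noteq> 0"
    by (rule qpoch_nonzero, unfold e', simp only: divide_eq_1_iff a pos simp_thms)+
qed

lemma (in generic) closed_form_altdef:
  "closed_form q a m = (1 - q ^ (4 * m + 1)) / (1 - q) * (qpoch (a * q ^ 2) (q ^ 4) m * qpoch (q ^ 2 / a) (q ^ 4) m
     / (qpoch (q ^ 4 / a) (q ^ 4) m * qpoch (a * q ^ 4) (q ^ 4) m))" (is "_ = ?c / _ * ?w")
proof -
  have "?c / (1 - q) * ?w = (?c * ?w) / (1 - q)"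
    by (rule times_divide_eq_left)
  also have "\<dots> = closed_form q a m"
    unfolding closed_form_eq[symmetric] using q1[of 1] by simp
  finally show ?thesis ..
qed

text \<open>The value is given in the telescoped form, without \<open>(q;q^4)_m\<close> in the
  denominator. That is why \<open>z\<close> may be a root of unity other than 1, although
  \<open>q\<close> is generic.\<close>

lemma has_value_closed_form:
  assumes "generic q" "place \<phi>" "has_value \<phi> q z" "has_value \<phi> a \<alpha>" "z \<noteq> 1" "admissible z \<alpha>"
  shows "has_value \<phi> (closed_form q a m)
    ((1 - z ^ (4 * m + 1)) / (1 - z) * (qpoch (\<alpha> * z ^ 2) (z ^ 4) m * qpoch (z ^ 2 / \<alpha>) (z ^ 4) m
     / (qpoch (z ^ 4 / \<alpha>) (z ^ 4) m * qpoch (\<alpha> * z ^ 4) (z ^ 4) m)))"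
proof -
  interpret generic q by fact
  show ?thesis
    unfolding closed_form_altdef
    by (intro has_value_mult has_value_divide has_value_diff has_value_qpoch has_value_1 has_value_power assms(2-4))
      (use assms(5,6) admissible_qpoch_nonzero[OF assms(6)] in \<open>simp_all add: admissible_def\<close>)
qed

lemma has_value_rhs:
  assumes "place \<phi>" "has_value \<phi> q z" "has_value \<phi> a \<alpha>" "has_value \<phi> b \<beta>" "\<alpha> \<noteq> \<beta>" "\<alpha> * \<beta> \<noteq> 1"
    and "has_value \<phi> (closed_form q a ((n - 1) div 4)) v" "has_value \<phi> (closed_form q b ((n - 1) div 4)) w"
  shows "has_value \<phi> (rhs q a b n)
   ((1 - \<alpha> * z ^ n) * (\<alpha> - z ^ n) * (- 1 - \<beta>\<^sup>2 + \<beta> * z ^ n) / ((\<beta> - \<alpha>) * (1 - \<beta> * \<alpha>)) * v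
    + (1 - \<beta> * z ^ n) * (\<beta> - z ^ n) * (- 1 - \<alpha>\<^sup>2 + \<alpha> * z ^ n) / ((\<alpha> - \<beta>) * (1 - \<alpha> * \<beta>)) * w)"
  unfolding rhs_def
  by (intro has_value_add has_value_mult has_value_divide has_value_diff has_value_minus has_value_1 has_value_power assms)
    (use assms(5,6) in \<open>simp_all add: mult.commute\<close>)

lemma has_value_summand_generic:
  assumes "generic z" "place \<phi>" "has_value \<phi> q z" "has_value \<phi> a \<alpha>" "has_value \<phi> b \<beta>" "admissible z \<alpha>" "admissible z \<beta>"
  shows "has_value \<phi> (summand q a b k) (summand z \<alpha> \<beta> k)"
proof -
  interpret generic z by fact
  have "z^4 * (z^4) ^ j \<noteq> 1" for j
    using q1[of "4 * Suc j"] by (simp only: power_mult power_Suc) simp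
  then have "qpoch (z^4) (z^4) k \<noteq> 0"
    by (rule qpoch_nonzero)
  then show ?thesis
    using q1[of 1] assms(6,7) admissible_qpoch_nonzero[OF assms(6), of k] admissible_qpoch_nonzero[OF assms(7), of k]
    unfolding summand_def qint_def qpochs_Cons qpochs_Nil
    by (intro has_value_mult has_value_divide has_value_diff has_value_qpoch has_value_1 has_value_power assms(2-5))
      (simp_all add: admissible_def)
qed

text \<open>Here \<open>y\<close> stands for \<open>q^n\<close>. The third factor
  \<open>- 1 - \<beta>^2 + \<beta> * y\<close> is \<open>-1\<close> for \<open>\<beta> = y\<close>
  and \<open>- \<beta>^2\<close> for \<open>\<beta> = 1 / y\<close>; in both cases it turns the
  product into the denominator. So one coefficient is 1 where the other is 0.\<close>

lemma interpolation_coeff: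
  fixes \<alpha> \<beta> y :: "'a::field"
  assumes "\<beta> = y \<or> \<beta> = 1 / y" "y \<noteq> 0" "\<alpha> \<noteq> \<beta>" "\<alpha> * \<beta> \<noteq> 1"
  shows "(1 - \<beta> * y) * (\<beta> - y) = 0"
    and "(1 - \<alpha> * y) * (\<alpha> - y) * (- 1 - \<beta>\<^sup>2 + \<beta> * y) / ((\<beta> - \<alpha>) * (1 - \<beta> * \<alpha>)) = 1"
proof -
  show "(1 - \<beta> * y) * (\<beta> - y) = 0"
    using assms(1,2) by auto
  have "\<beta> * y = 1 \<or> \<beta> = y"
    using assms(1,2) by auto
  then have "(1 - \<alpha> * y) * (\<alpha> - y) * (- 1 - \<beta>\<^sup>2 + \<beta> * y) = (\<beta> - \<alpha>) * (1 - \<beta> * \<alpha>)"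
  proof
    assume "\<beta> * y = 1"
    then show ?thesis by algebra
  qed (simp add: power2_eq_square algebra_simps)
  then show "(1 - \<alpha> * y) * (\<alpha> - y) * (- 1 - \<beta>\<^sup>2 + \<beta> * y) / ((\<beta> - \<alpha>) * (1 - \<beta> * \<alpha>)) = 1"
    using assms(3,4) by (simp add: mult.commute)
qed

lemma interpolation_distinct:
  fixes \<alpha> \<beta> y :: "'a::field"
  assumes "\<beta> = y \<or> \<beta> = 1 / y" "y \<noteq> 0" "\<alpha> * y \<noteq> 1" "y \<noteq> \<alpha>"
  shows "\<alpha> \<noteq> \<beta>" "\<alpha> * \<beta> \<noteq> 1"
proof -
  have "\<alpha> \<noteq> 1 / y" "\<alpha> * (1 / y) \<noteq> 1"
    using assms(2-4) by (simp_all add: eq_divide_eq divide_eq_1_iff)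
  then show "\<alpha> \<noteq> \<beta>" "\<alpha> * \<beta> \<noteq> 1"
    using assms(1,3,4) by metis+
qed

lemma (in generic) admissible_power:
  assumes "odd n" "r = q ^ n \<or> r = 1 / q ^ n"
  shows "admissible q r"
proof -
  have 1: "q ^ (2 * j) \<noteq> q ^ n" for j
    using assms(1) by (auto simp: pow_eq_iff)
  moreover have 2: "q ^ n * q ^ (2 * j) \<noteq> 1" if "j > 0" for j
    using q1[of "n + 2 * j"] that by (simp add: power_add)
  moreover have "1 / q ^ n * q ^ (2 * j) \<noteq> 1" for j
    using 1[of j] q0 by (simp add: divide_eq_1_iff)
  moreover have "q ^ (2 * j) \<noteq> 1 / q ^ n" if "j > 0" for j
    using 2[of j] that q0 by (simp add: eq_divide_eq mult.commute)
  ultimately show ?thesis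
    using assms(2) q0 unfolding admissible_def by auto
qed

lemma admissible_transcendental:
  assumes "a \<noteq> 0" "\<And>j. a * q ^ j \<noteq> 1" "\<And>j. q ^ j \<noteq> a"
  shows "admissible q a"
  using assms by (simp add: admissible_def)

text \<open>At \<open>b = q^n\<close> or its inverse both sides take the value of the closed form in
  \<open>a\<close>: the sum because it terminates at \<open>m <= M\<close>, the right-hand side by
  interpolation.\<close>

lemma congruence_b:
  assumes q: "generic q" and z: "generic z" and place: "place \<phi>"
    and h: "has_value \<phi> q z" "has_value \<phi> a \<alpha>" "has_value \<phi> b \<beta>"
    and \<alpha>: "\<alpha> \<noteq> 0" "\<And>j. \<alpha> * z ^ j \<noteq> 1" "\<And>j. z ^ j \<noteq> \<alpha>"
    and n: "n mod 4 = 1" "(n - 1) div 2 \<le> M" and \<beta>: "\<beta> = z ^ n \<or> \<beta> = 1 / z ^ n"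
  shows "\<exists>v. has_value \<phi> (\<Sum>k=0..M. summand q a b k) v \<and> has_value \<phi> (rhs q a b n) v"
proof -
  interpret generic z by fact
  define m where "m = (n - 1) div 4"
  have "n = 4 * (n div 4) + 1"
    using mult_div_mod_eq[of 4 n] n(1) by simp
  then obtain j where j: "n = 4 * j + 1" ..
  have nm: "n = 4 * m + 1" and m: "m \<le> M"
    using n(2) by (simp_all add: m_def j)
  have "odd n" by (simp add: nm)
  then have adm: "admissible z \<alpha>" "admissible z \<beta>"
    using \<alpha> \<beta> by (auto intro: admissible_transcendental admissible_power)
  have z0: "z ^ n \<noteq> 0" using q0 by simp
  have ab: "\<alpha> \<noteq> \<beta>" "\<alpha> * \<beta> \<noteq> 1"
    using interpolation_distinct[OF \<beta> z0 \<alpha>(2,3)] by blast+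
  have "(\<Sum>k=0..M. summand z \<alpha> \<beta> k) = (\<Sum>k=0..M. summand z \<alpha> (z ^ n) k)"
    using \<beta> by (auto simp: summand_inverse)
  also have "\<dots> = closed_form z \<alpha> m"
    using \<alpha> m by (intro sum_summand_b) (simp_all add: nm)
  finally have lhs: "has_value \<phi> (\<Sum>k=0..M. summand q a b k) (closed_form z \<alpha> m)"
    using has_value_sum[OF place, of "{0..M}" "summand q a b" "summand z \<alpha> \<beta>"]
      has_value_summand_generic[OF z place h adm] by simp
  have z1: "z \<noteq> 1" using q1[of 1] by simp
  define v where "v = (1 - z ^ (4 * m + 1)) / (1 - z) * (qpoch (\<alpha> * z ^ 2) (z ^ 4) m * qpoch (z ^ 2 / \<alpha>) (z ^ 4) m
     / (qpoch (z ^ 4 / \<alpha>) (z ^ 4) m * qpoch (\<alpha> * z ^ 4) (z ^ 4) m))"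
  have v: "v = closed_form z \<alpha> m"
    unfolding v_def by (rule closed_form_altdef[symmetric])
  \<comment> \<open>The second closed form gets the coefficient 0, but it must have some value for
    the product to have one.\<close>
  obtain w where w: "has_value \<phi> (closed_form q b m) w"
    using has_value_closed_form[OF q place h(1,3) z1 adm(2)] by blast
  have "has_value \<phi> (rhs q a b n) (1 * closed_form z \<alpha> m + 0 / ((\<alpha> - \<beta>) * (1 - \<alpha> * \<beta>)) * w)"
    using has_value_rhs[OF place h ab has_value_closed_form[OF q place h(1,2) z1 adm(1)] w[unfolded m_def]]
    unfolding interpolation_coeff[OF \<beta> z0 ab] m_def[symmetric] v_def[symmetric] v by simp
  then show ?thesis
    using lhs by auto
qed

lemma rhs_commute: "rhs q a b n = rhs q b a n"
  by (simp add: rhs_def add.commute)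

text \<open>The summand is not symmetric in \<open>a\<close> and \<open>b\<close>, so this rests on
  the second summation formula, which needs \<open>2 * m <= M\<close>. The right-hand side is
  symmetric, so its interpolation is reused with the roles exchanged.\<close>

lemma congruence_a:
  assumes q: "generic q" and z: "generic z" and place: "place \<phi>"
    and h: "has_value \<phi> q z" "has_value \<phi> a \<alpha>" "has_value \<phi> b \<beta>"
    and \<beta>: "\<beta> \<noteq> 0" "\<And>j. \<beta> * z ^ j \<noteq> 1" "\<And>j. z ^ j \<noteq> \<beta>"
    and n: "n mod 4 = 1" "(n - 1) div 2 \<le> M" and \<alpha>: "\<alpha> = z ^ n \<or> \<alpha> = 1 / z ^ n"
  shows "\<exists>v. has_value \<phi> (\<Sum>k=0..M. summand q a b k) v \<and> has_value \<phi> (rhs q a b n) v"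
proof -
  interpret generic z by fact
  define m where "m = (n - 1) div 4"
  have "n = 4 * (n div 4) + 1"
    using mult_div_mod_eq[of 4 n] n(1) by simp
  then obtain j where j: "n = 4 * j + 1" ..
  have nm: "n = 4 * m + 1" and m: "2 * m \<le> M"
    using n(2) by (simp_all add: m_def j)
  have "odd n" by (simp add: nm)
  then have adm: "admissible z \<alpha>" "admissible z \<beta>"
    using \<alpha> \<beta> by (auto intro: admissible_transcendental admissible_power)
  have z0: "z ^ n \<noteq> 0" using q0 by simp
  have ba: "\<beta> \<noteq> \<alpha>" "\<beta> * \<alpha> \<noteq> 1"
    using interpolation_distinct[OF \<alpha> z0 \<beta>(2,3)] by blast+
  have "(\<Sum>k=0..M. summand z \<alpha> \<beta> k) = (\<Sum>k=0..M. summand z (z ^ n) \<beta> k)"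
    using \<alpha> by (auto simp: summand_inverse)
  also have "\<dots> = closed_form z \<beta> m"
    using \<beta> m by (intro sum_summand_a) (simp_all add: nm)
  finally have lhs: "has_value \<phi> (\<Sum>k=0..M. summand q a b k) (closed_form z \<beta> m)"
    using has_value_sum[OF place, of "{0..M}" "summand q a b" "summand z \<alpha> \<beta>"]
      has_value_summand_generic[OF z place h adm] by simp
  have z1: "z \<noteq> 1" using q1[of 1] by simp
  define v where "v = (1 - z ^ (4 * m + 1)) / (1 - z) * (qpoch (\<beta> * z ^ 2) (z ^ 4) m * qpoch (z ^ 2 / \<beta>) (z ^ 4) m
     / (qpoch (z ^ 4 / \<beta>) (z ^ 4) m * qpoch (\<beta> * z ^ 4) (z ^ 4) m))"
  have v: "v = closed_form z \<beta> m"
    unfolding v_def by (rule closed_form_altdef[symmetric])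
  obtain w where w: "has_value \<phi> (closed_form q a m) w"
    using has_value_closed_form[OF q place h(1,2) z1 adm(1)] by blast
  have "has_value \<phi> (rhs q b a n) (1 * closed_form z \<beta> m + 0 / ((\<beta> - \<alpha>) * (1 - \<beta> * \<alpha>)) * w)"
    using has_value_rhs[OF place h(1,3,2) ba has_value_closed_form[OF q place h(1,3) z1 adm(2)] w[unfolded m_def]]
    unfolding interpolation_coeff[OF \<alpha> z0 ba] m_def[symmetric] v_def[symmetric] v by simp
  then show ?thesis
    using lhs rhs_commute[of q a b n] by auto
qed

section \<open>The images of the three indeterminates under the substitutions\<close>

lemma indeterminate_fract:
  fixes c :: "'a::idom"
  shows "to_fract [:0, 1:] \<noteq> 0" "to_fract [:0, 1:] * to_fract [:c:] \<noteq> 1" "to_fract [:c:] \<noteq> to_fract [:0, 1:]"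
proof -
  show "to_fract [:0, 1:] * to_fract [:c:] \<noteq> 1"
    by (simp only: to_fract_1[symmetric] to_fract_mult[symmetric] to_fract_eq_iff) (simp add: one_pCons)
qed simp_all

lemma to_fract_power: "to_fract x ^ n = to_fract (x ^ n)"
  by (rule place_power[OF place_to_fract, symmetric])

lemma place_place_const: "place (\<lambda>c::'a::field. to_fract [:to_fract [:c:]:])"
  by (rule place_comp[OF place_const place_const])

lemma has_value_indet:
  "has_value (place_b r) indet_q (to_fract [:[:0, 1:]:])"
  "has_value (place_b r) indet_a (to_fract [:0, 1:])"
  "has_value (place_b r) indet_b r"
  "has_value (place_a s) indet_q (to_fract [:to_fract [:0, 1:]:])"
  "has_value (place_a s) indet_a (to_fract [:s:])"
  "has_value (place_a s) indet_b (to_fract [:0, 1:])"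
  "has_value (place_zeta \<zeta>) indet_q (to_fract [:to_fract [:\<zeta>:]:])"
  "has_value (place_zeta \<zeta>) indet_a (to_fract [:to_fract [:0, 1:]:])"
  "has_value (place_zeta \<zeta>) indet_b (to_fract [:0, 1:])"
proof -
  note hb = has_value_to_fract[OF place_place_b] and ha = has_value_to_fract[OF place_place_a]
    and hz = has_value_to_fract[OF place_place_zeta]
  show "has_value (place_b r) indet_q (to_fract [:[:0, 1:]:])"
    using hb[of r "[:[:[:0, 1:]:]:]"] by (simp add: indet_q_def place_b_def map_poly_pCons)
  show "has_value (place_b r) indet_a (to_fract [:0, 1:])"
    using hb[of r "[:[:0, 1:]:]"] by (simp add: indet_a_def place_b_def map_poly_pCons)
  show "has_value (place_b r) indet_b r"
    using hb[of r "[:0, 1:]"] by (simp add: indet_b_def place_b_def map_poly_pCons)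
  show "has_value (place_a s) indet_q (to_fract [:to_fract [:0, 1:]:])"
    using ha[of s "[:[:[:0, 1:]:]:]"] by (simp add: indet_q_def place_a_def map_poly_pCons)
  show "has_value (place_a s) indet_a (to_fract [:s:])"
    using ha[of s "[:[:0, 1:]:]"] by (simp add: indet_a_def place_a_def map_poly_pCons)
  show "has_value (place_a s) indet_b (to_fract [:0, 1:])"
    using ha[of s "[:0, 1:]"] by (simp add: indet_b_def place_a_def map_poly_pCons)
  show "has_value (place_zeta \<zeta>) indet_q (to_fract [:to_fract [:\<zeta>:]:])"
    using hz[of \<zeta> "[:[:[:0, 1:]:]:]"] by (simp add: indet_q_def place_zeta_def map_poly_pCons)
  show "has_value (place_zeta \<zeta>) indet_a (to_fract [:to_fract [:0, 1:]:])"
    using hz[of \<zeta> "[:[:0, 1:]:]"] by (simp add: indet_a_def place_zeta_def map_poly_pCons)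
  show "has_value (place_zeta \<zeta>) indet_b (to_fract [:0, 1:])"
    using hz[of \<zeta> "[:0, 1:]"] by (simp add: indet_b_def place_zeta_def map_poly_pCons)
qed

lemma generic_indet_q: "generic indet_q"
proof
  show "indet_q \<noteq> 0"
    by (simp add: indet_q_def)
  fix j :: nat assume "j > 0"
  have "[:[:[:0, 1:] ^ j:]:] \<noteq> (1 :: poly_qab)"
    using x_power_neq_1[OF \<open>j > 0\<close>, where 'a = rat] by (simp add: one_pCons)
  then show "indet_q ^ j \<noteq> 1"
    unfolding indet_q_def to_fract_power const_poly_power by (simp only: to_fract_1[symmetric] to_fract_eq_iff not_False_eq_True)
qed

lemma generic_q_b: "generic (to_fract [:[:0, 1:]:] :: rat poly poly fract)"
proof
  fix j :: nat assume "j > 0"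
  have "[:[:0, 1:] ^ j:] \<noteq> (1 :: rat poly poly)"
    using x_power_neq_1[OF \<open>j > 0\<close>, where 'a = rat] by (simp add: one_pCons)
  then show "to_fract [:[:0, 1:]:] ^ j \<noteq> (1 :: rat poly poly fract)"
    unfolding to_fract_power const_poly_power by (simp only: to_fract_1[symmetric] to_fract_eq_iff not_False_eq_True)
qed simp

lemma generic_q_a: "generic (to_fract [:to_fract [:0, 1:]:] :: rat poly fract poly fract)"
proof
  fix j :: nat assume "j > 0"
  have "to_fract ([:0, 1:] ^ j) \<noteq> (1 :: rat poly fract)"
    using x_power_neq_1[OF \<open>j > 0\<close>, where 'a = rat] by (simp only: to_fract_1[symmetric] to_fract_eq_iff not_False_eq_True)
  then have "[:to_fract ([:0, 1:] ^ j):] \<noteq> (1 :: rat poly fract poly)"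
    by (simp add: one_pCons)
  then show "to_fract [:to_fract [:0, 1:]:] ^ j \<noteq> (1 :: rat poly fract poly fract)"
    unfolding to_fract_power const_poly_power by (simp only: to_fract_1[symmetric] to_fract_eq_iff not_False_eq_True)
qed simp

text \<open>The order of \<open>\<zeta>\<close> divides the odd number \<open>n\<close> and exceeds
  1, so it is \<open>2 * h' + 1\<close> with \<open>h' > 0\<close>. The values of \<open>a\<close>
  and \<open>b\<close> remain indeterminates and cannot meet any power of
  \<open>\<zeta>\<close>.\<close>

lemma congruence_zeta:
  fixes \<zeta> :: complex
  assumes n: "n mod 4 = 1" and M: "M = (n - 1) div 2 \<or> M = n - 1" and \<zeta>: "\<zeta> ^ n = 1" "\<zeta> \<noteq> 1"
  shows "has_value (place_zeta \<zeta>) (\<Sum>k=0..M. summand indet_q indet_a indet_b k) 0"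
    and "has_value (place_zeta \<zeta>) (rhs indet_q indet_a indet_b n) 0"
proof -
  \<comment> \<open>Embeds the complex numbers as constants into the target field; by injectivity
    \<open>z\<close> has the same order as \<open>\<zeta>\<close>, and characteristic 0 is
    inherited.\<close>
  define \<kappa> where "\<kappa> = (\<lambda>c::complex. to_fract [:to_fract [:c:]:])"
  have \<kappa>: "place \<kappa>"
    unfolding \<kappa>_def by (rule place_place_const)
  define z where "z = \<kappa> \<zeta>"
  define \<alpha> \<beta> :: "complex poly fract poly fract" where "\<alpha> = to_fract [:to_fract [:0, 1:]:]" and "\<beta> = to_fract [:0, 1:]"
  have z_pow: "z ^ i = \<kappa> (\<zeta> ^ i)" for i
    by (simp add: z_def place_power[OF \<kappa>])
  have z_1: "z ^ i = 1 \<longleftrightarrow> \<zeta> ^ i = 1" for i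
    unfolding z_pow using place_field_inj[OF \<kappa>, of "\<zeta> ^ i" 1] by (simp add: place_1[OF \<kappa>])
  have h: "has_value (place_zeta \<zeta>) indet_q z" "has_value (place_zeta \<zeta>) indet_a \<alpha>" "has_value (place_zeta \<zeta>) indet_b \<beta>"
    unfolding z_def \<kappa>_def \<alpha>_def \<beta>_def by (rule has_value_indet)+
  have \<beta>: "\<beta> \<noteq> 0" "\<beta> * z ^ j \<noteq> 1" "z ^ j \<noteq> \<beta>" for j
    unfolding z_pow \<beta>_def \<kappa>_def by (rule indeterminate_fract)+
  have \<alpha>: "\<alpha> \<noteq> 0" "\<alpha> * z ^ j \<noteq> 1" "z ^ j \<noteq> \<alpha>" for j
  proof -
    show "\<alpha> \<noteq> 0"
      unfolding \<alpha>_def by simp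
    have "to_fract [:to_fract [:0, 1:] * to_fract [:\<zeta> ^ j:]:] \<noteq> to_fract [:1:]"
      unfolding to_fract_eq_iff pCons_eq_iff using indeterminate_fract(2) by blast
    then show "\<alpha> * z ^ j \<noteq> 1"
      unfolding z_pow \<alpha>_def \<kappa>_def by (simp flip: to_fract_mult add: pCons_one)
    show "z ^ j \<noteq> \<alpha>"
      by (simp add: z_pow \<alpha>_def \<kappa>_def)
  qed
  have ab: "\<alpha> \<noteq> \<beta>" "\<alpha> * \<beta> \<noteq> 1"
    unfolding \<alpha>_def \<beta>_def using indeterminate_fract(2,3) by (metis mult.commute)+
  have n0: "n > 0" using n by (auto intro: gr0I)
  define d where "d = (LEAST i. i > 0 \<and> \<zeta> ^ i = 1)"
  have d: "d > 0" "\<zeta> ^ d = 1"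
    using LeastI[of "\<lambda>i. i > 0 \<and> \<zeta> ^ i = 1" n] n0 \<zeta>(1) unfolding d_def by auto
  have d_least: "\<zeta> ^ i \<noteq> 1" if "0 < i" "i < d" for i
    using not_less_Least[of i "\<lambda>i. i > 0 \<and> \<zeta> ^ i = 1"] that unfolding d_def by blast
  have "\<zeta> ^ n = (\<zeta> ^ d) ^ (n div d) * \<zeta> ^ (n mod d)"
    by (simp flip: power_mult power_add)
  then have "n mod d = 0"
    using d_least[of "n mod d"] d \<zeta>(1) by fastforce
  then obtain e where e: "n = e * d"
    by (metis dvd_def mod_0_imp_dvd mult.commute)
  have "odd n"
    using n mod_mod_cancel[of 2 4 n] by (simp add: odd_iff_mod_2_eq_one)
  then have "odd d" "odd e" by (simp_all add: e)
  then obtain h' f where h': "d = 2 * h' + 1" and f: "e = 2 * f + 1"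
    by (auto elim!: oddE)
  have "h' > 0"
    using \<zeta>(2) d(2) h' by (intro gr0I) simp
  interpret R: root_of_unity z h'
  proof
    show "z ^ (2 * h' + 1) = 1"
      unfolding z_1 using d(2) by (simp only: h')
    show "z ^ i \<noteq> 1" if "0 < i" "i < 2 * h' + 1" for i
      unfolding z_1 by (rule d_least) (use that in \<open>simp_all only: h'\<close>)
    fix i
    have "\<kappa> (of_nat (Suc i)) \<noteq> \<kappa> 0"
      unfolding place_field_inj[OF \<kappa>] using of_nat_neq_0 by blast
    then show "of_nat (Suc i) \<noteq> (0 :: complex poly fract poly fract)"
      by (simp only: place_of_nat[OF \<kappa>] place_0[OF \<kappa>] not_False_eq_True)
  qed fact
  interpret G: generic indet_q
    by (rule generic_indet_q)
  have qj: "indet_q ^ j = to_fract [:[:[:0, 1:] ^ j:]:]" for j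
    by (simp only: indet_q_def to_fract_power const_poly_power)
  interpret P: root_of_unity_place z h' indet_q "place_zeta \<zeta>" indet_a indet_b \<alpha> \<beta>
  proof
    fix j
    have "[:[:0, 1:]:] * [:[:[:0, 1:] ^ j:]:] \<noteq> (1 :: poly_qab)"
      by (simp add: one_pCons)
    then show "indet_a * indet_q ^ j \<noteq> 1"
      unfolding indet_a_def qj by (simp only: to_fract_1[symmetric] to_fract_mult[symmetric] to_fract_eq_iff not_False_eq_True)
  qed (use \<alpha> \<beta> h in \<open>simp_all add: place_place_zeta qj indet_a_def indet_b_def\<close>)
  \<comment> \<open>With \<open>n = e * d\<close>, \<open>e = 2 * f + 1\<close> and
    \<open>d = 2 * h' + 1\<close>, one has \<open>n - 1 = 2 * (f * d + h')\<close>: half of the full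
    range ends in the middle of a block.\<close>
  have "M + 1 = e * R.d \<or> M = f * R.d + h'"
    using M
  proof
    assume "M = (n - 1) div 2"
    moreover have "n - 1 = 2 * (f * R.d + h')"
      by (simp add: e f h' R.d_def algebra_simps)
    ultimately show ?thesis by simp
  qed (use n0 e h' in \<open>simp add: R.d_def\<close>)
  then show "has_value (place_zeta \<zeta>) (\<Sum>k=0..M. summand indet_q indet_a indet_b k) 0"
    using P.has_value_sum_zero[of M e] P.has_value_sum_zero[of M f] by blast
  define m where "m = (n - 1) div 4"
  have "n = 4 * (n div 4) + 1"
    using mult_div_mod_eq[of 4 n] n by simp
  then obtain j where j: "n = 4 * j + 1" ..
  have nm: "n = 4 * m + 1"
    by (simp add: m_def j)
  \<comment> \<open>The telescoped closed forms carry the factor \<open>1 - z^(4 * m + 1)\<close>,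
    so both have the value 0.\<close>
  have z: "z \<noteq> 1" "z ^ (4 * m + 1) = 1"
    using z_1[of 1] z_1[of n] \<zeta> by (simp_all only: nm power_one_right) simp_all
  have "has_value (place_zeta \<zeta>) (closed_form indet_q indet_a m) 0"
    using has_value_closed_form[OF generic_indet_q place_place_zeta h(1,2) z(1) admissible_transcendental[OF \<alpha>], of m]
    unfolding z(2) by simp
  moreover have "has_value (place_zeta \<zeta>) (closed_form indet_q indet_b m) 0"
    using has_value_closed_form[OF generic_indet_q place_place_zeta h(1,3) z(1) admissible_transcendental[OF \<beta>], of m]
    unfolding z(2) by simp
  ultimately show "has_value (place_zeta \<zeta>) (rhs indet_q indet_a indet_b n) 0"
    using has_value_rhs[OF place_place_zeta h ab, of n 0 0] by (simp add: m_def)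
qed

theorem theorem3p2:
  fixes n M :: nat and q a b :: ratfun_qab
  assumes "n > 0" and "n mod 4 = 1"
    and "M = (n - 1) div 2 \<or> M = n - 1"
    and "q = indet_q" and "a = indet_a" and "b = indet_b"
  shows "ratfun_cong
    (qint q n * (1 - a * q ^ n) * (a - q ^ n) * (1 - b * q ^ n) * (b - q ^ n))
    (\<Sum>k=0..M. qint q (6 * k + 1)
        * (qpochs [a * q, q / a] (q\<^sup>2) k * qpochs [q\<^sup>2, b * q, q / b] (q ^ 4) k)
        / (qpochs [q ^ 4, q ^ 4 / a, a * q ^ 4] (q ^ 4) k * qpochs [q\<^sup>2 / b, b * q\<^sup>2] (q\<^sup>2) k)
        * q ^ (2 * k))
    ((1 - a * q ^ n) * (a - q ^ n) * (- 1 - b\<^sup>2 + b * q ^ n) / ((b - a) * (1 - b * a))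
        * (qpochs [q ^ 5, a * q\<^sup>2, q\<^sup>2 / a] (q ^ 4) ((n - 1) div 4)
           / qpochs [q, q ^ 4 / a, a * q ^ 4] (q ^ 4) ((n - 1) div 4))
      + (1 - b * q ^ n) * (b - q ^ n) * (- 1 - a\<^sup>2 + a * q ^ n) / ((a - b) * (1 - a * b))
        * (qpochs [q ^ 5, b * q\<^sup>2, q\<^sup>2 / b] (q ^ 4) ((n - 1) div 4)
           / qpochs [q, q ^ 4 / b, b * q ^ 4] (q ^ 4) ((n - 1) div 4)))"
  unfolding summand_def[symmetric] closed_form_def[symmetric] rhs_def[symmetric] assms(4-6)
proof (rule ratfun_cong_qint)
  have le: "(n - 1) div 2 \<le> M"
    using assms(3) by auto
  show "n > 0" by fact
  show "has_value (place_zeta \<zeta>) (\<Sum>k=0..M. summand indet_q indet_a indet_b k) 0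
      \<and> has_value (place_zeta \<zeta>) (rhs indet_q indet_a indet_b n) 0" if "\<zeta> ^ n = 1" "\<zeta> \<noteq> 1" for \<zeta>
    using congruence_zeta[OF assms(2,3) that] by blast
  show "\<exists>v. has_value (place_b r) (\<Sum>k=0..M. summand indet_q indet_a indet_b k) v
      \<and> has_value (place_b r) (rhs indet_q indet_a indet_b n) v"
    if "r = to_fract [:[:0, 1:] ^ n:] \<or> r = 1 / to_fract [:[:0, 1:] ^ n:]" for r
    by (rule congruence_b[OF generic_indet_q generic_q_b place_place_b has_value_indet(1-3) _ _ _ assms(2) le])
      (use that indeterminate_fract in \<open>simp_all only: to_fract_power const_poly_power not_False_eq_True\<close>)
  show "\<exists>v. has_value (place_a r) (\<Sum>k=0..M. summand indet_q indet_a indet_b k) v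
      \<and> has_value (place_a r) (rhs indet_q indet_a indet_b n) v"
    if "r = to_fract ([:0, 1:] ^ n) \<or> r = 1 / to_fract ([:0, 1:] ^ n)" for r
  proof (rule congruence_a[OF generic_indet_q generic_q_a place_place_a has_value_indet(4-6) _ _ _ assms(2) le])
    \<comment> \<open>The value of \<open>a\<close> is the constant polynomial \<open>r\<close> in
      \<open>b\<close>. Passing to constants commutes with inversion, which brings
      \<open>r = 1 / c\<close> into the form required of \<open>\<alpha>\<close>.\<close>
    define c where "c = to_fract ([:0, 1:] ^ n :: rat poly)"
    have "c \<noteq> 0" by (simp add: c_def)
    then have "to_fract [:1 / c:] * to_fract [:c:] = to_fract [:1:]"
      by (simp flip: to_fract_mult)
    then have "to_fract [:1 / c:] = 1 / to_fract [:c:]"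
      using \<open>c \<noteq> 0\<close> by (simp add: eq_divide_eq pCons_one)
    then show "to_fract [:r:] = to_fract [:to_fract [:0, 1:]:] ^ n \<or> to_fract [:r:] = 1 / to_fract [:to_fract [:0, 1:]:] ^ n"
      using that unfolding to_fract_power const_poly_power c_def by auto
  qed (use indeterminate_fract in \<open>simp_all only: to_fract_power const_poly_power not_False_eq_True\<close>)
qed

end
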